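(* (1) At most six inner ribs are used in any puzzle. (2) At most six outer ribs are used in any puzzle. (3) At most ten inner and outer ribs (that is, counting inner ribs and outer ribs together) are used in any puzzle.
   Context: Let $\mathbb{H} = \mathbb{R} \oplus \mathbb{I}$ be the quaternions, identified with $\mathbb{R}^4$ with orthonormal basis $1, i, j, k$, where $\mathbb{I} = i\mathbb{R} \oplus j\mathbb{R} \oplus k\mathbb{R} \cong \mathbb{R}^3$ is the subspace of purely imaginary quaternions. Let $S^3 = \{q \in \mathbb{H} : |q| = 1\}$ be the group of unit quaternions, with metric $d_S(p,q) = \arccos \langle p, q\rangle$. For $q \in S^3$ let $\psi_q \in \mathrm{SO}(3) = \mathrm{Isom}^+_0(\mathbb{I})$ (the orientation-preserving isometries of $\mathbb{I}$ fixing the origin) be $\psi_q(p) = q p q^{-1}$; the map $\psi : S^3 \to \mathrm{SO}(3)$ is a two-to-one homomorphism. Set $x = \frac{1}{2}(\cot \frac{\pi}{5} + \cot \frac{2\pi}{5})$ and $y = \frac{1}{2}(\cot \frac{\pi}{5} - \cot \frac{2\pi}{5})$, so $x^2 + y^2 = 1$. Let $D \subset \mathbb{I}$ be the regular dodecahedron with vertices on the unit sphere of $\mathbb{I}$, positioned so that its twelve face centres lie in the directions $\pm x i \pm y j$, $\pm x j \pm y k$, $\pm y i \pm x k$ (all sign choices). Let $\mathcal{D} \subset \mathrm{SO}(3)$ be its group of orientation-preserving symmetries, and $\mathcal{D}^* = \psi^{-1}(\mathcal{D})$ the binary dodecahedral group (of order 120). The tiling $\mathcal{T}_{120}$ of $S^3$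 has three-cells $\mathrm{Vor}(q) = \{ r \in S^3 : d_S(q,r) \le d_S(p,r) \text{ for all } p \in \mathcal{D}^*\}$, $q \in \mathcal{D}^*$, which are regular spherical dodecahedra; the centre of $\mathrm{Vor}(q)$ is $q$. The south pole is $1$, the north pole is $-1$. Stereographic projection $\rho : S^3 - \{-1\} \to \mathbb{I} \cong \mathbb{R}^3$ is given by $\rho(\cos\alpha + u \sin\alpha) = \frac{\sin \alpha}{1 + \cos\alpha} u$ for $u \in \mathbb{I}$ with $|u| = 1$ and $\alpha \in [0,\pi)$. Rings. Let $f = x i + y j$, $f' = x j + y k$, $q = \cos\frac{\pi}{5} + f \sin\frac{\pi}{5}$, $q' = \cos\frac{\pi}{5} + f' \sin\frac{\pi}{5}$, and $R = \langle q \rangle < \mathcal{D}^*$, cyclic of order ten. The rings are the twelve right cosets of $R$ in $\mathcal{D}^*$ (each regarded as a set of ten cells of $\mathcal{T}_{120}$): the spinal ring $R$; the equatorial ring, which is the coset all of whose elements are at distance $\pi/2$ from $1$; the five inner rings $R \cdot q' q^{-i}$, $i = 0,1,2,3,4$; and the five outer rings, which are the remaining five cosets. Ribs. A rib is the image under $\rho$ of a union of cells of a ring, as follows. The spine, an inner six, or an outer six is obtained from the spinal ring, an inner ring, or an outer ring, respectively, by keeping exactly the cells with centres at distance at most $\pi/2$ from $1$. An inner four or outer four is obtained from an inner six or outer six by deleting the two cells with centres at distance $\pi/2$ from $1$. An equator rib is one half (five consecutive cells) of the equatorial ring. An inner rib is an inner six or an inner four; an outer rib is an outer six or an outer four. Puzzles.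 A puzzle is a finite collection of copies of ribs (with repetition of rib types allowed), each moved by an orientation-preserving isometry of $\mathbb{R}^3$ so that each of its projected dodecahedra is carried onto $\rho(\mathrm{Vor}(p))$ for some $p \in \mathcal{D}^* - \{-1\}$, and such that no two of the placed copies share a cell (the placed copies have disjoint interiors). *)

theory Defs
  imports "HOL-Analysis.Analysis" "HOL-Algebra.Coset" "HOL-Algebra.Generated_Groups"
begin

text \<open>
  A quaternion \<open>a + b i + c j + d k\<close> is the pair of its real part \<open>a\<close> and its imaginary part
  \<open>(b, c, d)\<close>. The library's inner product and norm on \<open>real \<times> real ^ 3\<close> are those making
  \<open>1, i, j, k\<close> orthonormal.
\<close>

type_synonym quat = "real \<times> (real ^ 3)"

definition qmult :: "quat \<Rightarrow> quat \<Rightarrow> quat" where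
  "qmult p q = (fst p * fst q - snd p \<bullet> snd q,
     fst p *\<^sub>R snd q + fst q *\<^sub>R snd p + cross3 (snd p) (snd q))"

definition qone :: quat where
  "qone = (1, 0)"

lemma qmult_units:
  defines "i \<equiv> (0, vector [1, 0, 0])" and "j \<equiv> (0, vector [0, 1, 0])"
    and "k \<equiv> (0, vector [0, 0, 1])"
  shows "qmult i j = k" "qmult j k = i" "qmult k i = j"
    "qmult i i = - qone" "qmult j j = - qone" "qmult k k = - qone"
  unfolding i_def j_def k_def
  by (simp_all add: qmult_def qone_def cross3_def inner_vec_def sum_3 vec_eq_iff forall_3)

definition S3 :: "quat monoid" where
  "S3 = \<lparr>carrier = sphere 0 1, mult = qmult, one = qone\<rparr>"

definition dS :: "quat \<Rightarrow> quat \<Rightarrow> real" where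
  "dS p q = arccos (p \<bullet> q)"

definition SO3 :: "(real ^ 3 \<Rightarrow> real ^ 3) set" where
  "SO3 = {f. orthogonal_transformation f \<and> det (matrix f) = 1}"

definition psi :: "quat \<Rightarrow> real ^ 3 \<Rightarrow> real ^ 3" where
  "psi q v = snd (qmult (qmult q (0, v)) (inv\<^bsub>S3\<^esub> q))"

definition x_coord :: real where
  "x_coord = (cot (pi / 5) + cot (2 * pi / 5)) / 2"

definition y_coord :: real where
  "y_coord = (cot (pi / 5) - cot (2 * pi / 5)) / 2"

definition face_directions :: "(real ^ 3) set" where
  "face_directions =
     (\<Union>s\<in>{1, -1}. \<Union>t\<in>{1, -1}.
        {vector [s * x_coord, t * y_coord, 0],
         vector [0, s * x_coord, t * y_coord],
         vector [s * y_coord, 0, t * x_coord]})"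

text \<open>
  The face directions are unit vectors, so the dodecahedron is cut out by the half-spaces
  \<open>n \<bullet> v \<le> c\<close>, with \<open>c\<close> the inradius. The circumradius is 1 for \<open>c = cot (pi / 5) / sqrt 3\<close>: the
  vertex \<open>(1, 1, 1) / sqrt 3\<close> lies on the faces with normals \<open>(x, y, 0)\<close>, \<open>(0, x, y)\<close>, \<open>(y, 0, x)\<close>,
  and \<open>x + y = cot (pi / 5)\<close>.
\<close>

definition dodecahedron :: "(real ^ 3) set" where
  "dodecahedron = {v. \<forall>n\<in>face_directions. n \<bullet> v \<le> cot (pi / 5) / sqrt 3}"

definition dodecahedral_group :: "(real ^ 3 \<Rightarrow> real ^ 3) set" where
  "dodecahedral_group = {f \<in> SO3. f ` dodecahedron = dodecahedron}"

definition Dstar :: "quat set" where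
  "Dstar = {q \<in> carrier S3. psi q \<in> dodecahedral_group}"

definition Vor :: "quat \<Rightarrow> quat set" where
  "Vor q = {r \<in> carrier S3. \<forall>p\<in>Dstar. dS q r \<le> dS p r}"

text \<open>
  Writing a point of the sphere as \<open>cos \<alpha> + u sin \<alpha>\<close> with \<open>u\<close> an imaginary unit, its imaginary
  part is \<open>u sin \<alpha>\<close>. The value at the north pole \<open>- qone\<close> is irrelevant.
\<close>

definition rho :: "quat \<Rightarrow> real ^ 3" where
  "rho p = (1 / (1 + fst p)) *\<^sub>R snd p"

lemma rho_polar: "rho (cos \<alpha>, sin \<alpha> *\<^sub>R u) = (sin \<alpha> / (1 + cos \<alpha>)) *\<^sub>R u"
  by (simp add: rho_def)

definition ring_gen :: quat where
  "ring_gen = (cos (pi / 5), sin (pi / 5) *\<^sub>R vector [x_coord, y_coord, 0])"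

definition ring_gen' :: quat where
  "ring_gen' = (cos (pi / 5), sin (pi / 5) *\<^sub>R vector [0, x_coord, y_coord])"

text \<open>A ring is represented by the set of centres of its cells.\<close>

definition spinal_ring :: "quat set" where
  "spinal_ring = generate S3 {ring_gen}"

definition rings :: "quat set set" where
  "rings = rcosets\<^bsub>S3\<lparr>carrier := Dstar\<rparr>\<^esub> spinal_ring"

definition equatorial_rings :: "quat set set" where
  "equatorial_rings = {A \<in> rings. \<forall>p\<in>A. dS p qone = pi / 2}"

definition inner_rings :: "quat set set" where
  "inner_rings =
     (\<lambda>i. spinal_ring #>\<^bsub>S3\<^esub> (ring_gen' \<otimes>\<^bsub>S3\<^esub> inv\<^bsub>S3\<^esub> (ring_gen [^]\<^bsub>S3\<^esub> i))) ` {0..4::nat}"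

definition outer_rings :: "quat set set" where
  "outer_rings = rings - {spinal_ring} - equatorial_rings - inner_rings"

text \<open>
  A rib is likewise represented by the set of centres of the cells it is made of.
  The cell centred at \<open>p\<close> is adjacent in its ring to those centred at \<open>ring_gen \<cdot> p\<close> and
  \<open>ring_gen\<inverse> \<cdot> p\<close>.
\<close>

definition southern :: "quat set \<Rightarrow> quat set" where
  "southern A = {p \<in> A. dS p qone \<le> pi / 2}"

definition strictly_southern :: "quat set \<Rightarrow> quat set" where
  "strictly_southern A = southern A - {p. dS p qone = pi / 2}"

definition spine_ribs :: "quat set set" where
  "spine_ribs = {southern spinal_ring}"

definition inner_ribs :: "quat set set" where
  "inner_ribs = southern ` inner_rings \<union> strictly_southern ` inner_rings"

definition outer_ribs :: "quat set set" where
  "outer_ribs = southern ` outer_rings \<union> strictly_southern ` outer_rings"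

definition equator_ribs :: "quat set set" where
  "equator_ribs =
     (\<Union>A\<in>equatorial_rings. \<Union>p\<in>A. {(\<lambda>m. ring_gen [^]\<^bsub>S3\<^esub> m \<otimes>\<^bsub>S3\<^esub> p) ` {0..4::nat}})"

definition ribs :: "quat set set" where
  "ribs = spine_ribs \<union> inner_ribs \<union> outer_ribs \<union> equator_ribs"

definition orientation_preserving_isometry :: "(real ^ 3 \<Rightarrow> real ^ 3) \<Rightarrow> bool" where
  "orientation_preserving_isometry g \<longleftrightarrow> (\<exists>f\<in>SO3. \<exists>b. g = (\<lambda>v. f v + b))"

text \<open>A placed copy of a rib is the rib together with the isometry by which it is moved.\<close>

type_synonym placed_rib = "quat set \<times> (real ^ 3 \<Rightarrow> real ^ 3)"

definition placed_cells :: "placed_rib \<Rightarrow> (real ^ 3) set set" where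
  "placed_cells P = (\<lambda>c. snd P ` rho ` Vor c) ` fst P"

definition valid_placement :: "placed_rib \<Rightarrow> bool" where
  "valid_placement P \<longleftrightarrow>
     fst P \<in> ribs \<and> orientation_preserving_isometry (snd P) \<and>
     placed_cells P \<subseteq> (\<lambda>p. rho ` Vor p) ` (Dstar - {- qone})"

definition puzzle :: "placed_rib list \<Rightarrow> bool" where
  "puzzle Ps \<longleftrightarrow>
     (\<forall>P\<in>set Ps. valid_placement P) \<and>
     (\<forall>k<length Ps. \<forall>l<length Ps. k \<noteq> l \<longrightarrow> placed_cells (Ps ! k) \<inter> placed_cells (Ps ! l) = {})"

definition num_placed :: "quat set set \<Rightarrow> placed_rib list \<Rightarrow> nat" where
  "num_placed Rs Ps = length (filter (\<lambda>P. fst P \<in> Rs) Ps)"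

end

theory Submission
  imports Defs
begin

text \<open>
  The cells of \<open>\<T>\<^sub>1\<^sub>2\<^sub>0\<close> lie in layers according to the real part of their centre, that is, its
  distance from the south pole. Three layers matter: with \<open>\<phi> = 2 cos (\<pi> / 5)\<close> the golden ratio,
  there are 12 centres of real part \<open>\<phi> / 2\<close>, 20 of real part \<open>1 / 2\<close> and 12 of real part
  \<open>(\<phi> - 1) / 2\<close>. Every inner rib contains two cells of the first layer and two of the second, every
  outer rib two of the second and two of the third. Once it is known that a placed rib sends each
  cell to a cell of the same layer, and distinct cells to distinct cells, disjointness of the
  placed ribs gives \<open>2 a \<le> 12\<close>, \<open>2 b \<le> 12\<close> and \<open>2 (a + b) \<le> 20\<close> for the numbers \<open>a\<close> and \<open>b\<close>
  of inner and outer ribs (\<open>num_placed_le\<close>).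

  Layers are preserved because congruent projected cells lie in the same layer
  (\<open>congruent_cells_same_layer\<close>). The invariant is the largest radius of a ball contained in the
  projected cell \<open>\<rho>(Vor p)\<close>; for \<open>Re p \<ge> 0\<close> it equals \<open>sin (\<pi> / 10) / (cos (\<pi> / 10) + Re p)\<close>. The
  lower bound, valid for all \<open>p \<noteq> -1\<close>, comes from the inscribed spherical cap of angular radius
  \<open>\<pi> / 10\<close> (\<open>ball_in_cell\<close>). For the upper bound (\<open>ball_in_cell_radius\<close>), a ball of centre \<open>c\<close> and
  radius \<open>r\<close> is the image of a spherical cap, encoded by a vector \<open>w\<close> of \<open>\<real>\<^sup>4\<close> and a height \<open>h\<close> with
  \<open>|w|\<^sup>2 = h\<^sup>2 + 1\<close> and \<open>h + Re w = 1 / r\<close>. Being contained in the half-space with unit normal \<open>N\<close>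
  means \<open>w \<bullet> N \<ge> 1\<close>, and the twelve such inequalities given by the faces of the cell bound
  \<open>h + Re w\<close> from below (\<open>curvature_bound\<close>).

  The combinatorics of the binary dodecahedral group come from its action on the twelve face
  directions. The stabiliser of \<open>f\<close> is the spinal ring \<open>R\<close>, so the coset \<open>R g\<close> is determined by the
  face direction \<open>\<psi>(g\<inverse>) f\<close>. The direction \<open>f\<close> gives \<open>R\<close> itself, \<open>-f\<close> gives the equatorial ring,
  the five neighbours of \<open>f\<close> give the inner rings \<open>R q' q\<^bsup>-j\<^esup>\<close>, and the remaining five directions
  give the rings \<open>R q'\<^bsup>2\<^esup> q\<^bsup>-j\<^esup>\<close>, which are therefore the outer ones (\<open>Dstar_cases\<close>). Along each
  ring the real parts satisfy the recurrence \<open>a\<^bsub>n+2\<^esub> = \<phi> a\<^bsub>n+1\<^esub> - a\<^bsub>n\<^esub>\<close>, which yields all of them.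
\<close>

section \<open>Unit quaternions and their rotations\<close>

text \<open>
  Membership in the unit sphere is kept folded: it is used either as a premise of the group laws or,
  by \<open>sphere_quat\<close> below, in terms of the inner product.
\<close>
declare mem_sphere [simp del] mem_sphere_0 [simp del]

lemma S3_simps [simp]:
  "carrier S3 = sphere 0 1" "mult S3 = qmult" "one S3 = qone"
  by (simp_all add: S3_def)

text \<open>
  Quaternion conjugation, the inverse on the unit sphere.
\<close>
definition qcnj :: "quat \<Rightarrow> quat" where
  "qcnj q = (fst q, - snd q)"

lemma qcnj_simps [simp]: "fst (qcnj q) = fst q" "snd (qcnj q) = - snd q" "qcnj (qcnj q) = q"
  by (simp_all add: qcnj_def)

lemma qmult_assoc: "qmult (qmult p q) r = qmult p (qmult q r)"
  by (simp add: qmult_def prod_eq_iff cross3_simps forall_3)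

lemma qmult_one [simp]: "qmult qone q = q" "qmult q qone = q"
  by (simp_all add: qmult_def qone_def)

lemma inner_quat: "(p :: quat) \<bullet> q = fst p * fst q + snd p \<bullet> snd q"
  by (simp add: inner_prod_def)

lemma inner_qmult_left: "qmult r p \<bullet> qmult r q = (r \<bullet> r) * (p \<bullet> q)"
  by (simp add: inner_quat qmult_def cross3_simps)

lemma inner_qmult_right: "qmult p r \<bullet> qmult q r = (r \<bullet> r) * (p \<bullet> q)"
  by (simp add: inner_quat qmult_def cross3_simps)

lemma inner_qmult_cnj: "qmult r p \<bullet> q = p \<bullet> qmult (qcnj r) q"
  by (simp add: inner_quat qmult_def cross3_simps)

lemma fst_qmult_cnj: "fst (qmult (qcnj p) q) = p \<bullet> q"
  by (simp add: inner_quat qmult_def)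

lemma sphere_quat: "q \<in> sphere 0 1 \<longleftrightarrow> (q :: quat) \<bullet> q = 1"
  by (simp add: mem_sphere_0 norm_eq_1)

lemma qmult_sphere: "p \<in> sphere 0 1 \<Longrightarrow> q \<in> sphere 0 1 \<Longrightarrow> qmult p q \<in> sphere 0 1"
  by (simp only: sphere_quat inner_qmult_left)

lemma qcnj_sphere: "p \<in> sphere 0 1 \<Longrightarrow> qcnj p \<in> sphere 0 1"
  by (simp only: sphere_quat inner_quat qcnj_simps) simp

lemma qone_sphere: "qone \<in> sphere 0 1"
  by (simp only: sphere_quat inner_quat qone_def) simp

lemma qmult_cnj:
  assumes "p \<in> sphere 0 1"
  shows "qmult p (qcnj p) = qone" "qmult (qcnj p) p = qone"
  using assms unfolding sphere_quat inner_quat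
  by (simp_all add: qmult_def qone_def prod_eq_iff cross3_simps)

lemma group_S3: "group S3"
  by (rule groupI)
    (auto simp: qmult_assoc intro: qmult_sphere qone_sphere intro!: bexI[OF _ qcnj_sphere] qmult_cnj)

interpretation S3: group S3 by (rule group_S3)

lemma inv_S3: "p \<in> sphere 0 1 \<Longrightarrow> inv\<^bsub>S3\<^esub> p = qcnj p"
  by (rule S3.inv_equality) (simp_all add: qmult_cnj qcnj_sphere)

lemma qcnj_qmult: "qcnj (qmult p q) = qmult (qcnj q) (qcnj p)"
  by (simp add: qmult_def prod_eq_iff cross3_simps)

text \<open>
  Rodrigues' formula for the rotation about the imaginary part of \<open>q\<close>.
\<close>
lemma psi_eq:
  assumes "q \<in> sphere 0 1"
  shows "psi q v = (fst q ^ 2 - snd q \<bullet> snd q) *\<^sub>R v + (2 * (snd q \<bullet> v)) *\<^sub>R snd q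
    + (2 * fst q) *\<^sub>R cross3 (snd q) v"
  unfolding psi_def inv_S3[OF assms]
  by (simp add: qmult_def cross3_simps power2_eq_square forall_3)

lemma qmult_psi:
  assumes "q \<in> sphere 0 1"
  shows "qmult (qmult q (0, v)) (qcnj q) = (0, psi q v)"
  unfolding psi_def inv_S3[OF assms]
  by (simp add: qmult_def prod_eq_iff cross3_simps)

lemma qmult_psi_comm:
  assumes "q \<in> sphere 0 1"
  shows "qmult q (0, v) = qmult (0, psi q v) q"
  by (simp add: qmult_psi[OF assms, symmetric] qmult_assoc qmult_cnj[OF assms])

lemma psi_qmult:
  assumes "p \<in> sphere 0 1" "q \<in> sphere 0 1"
  shows "psi (qmult p q) v = psi p (psi q v)"
proof -
  have "(0, psi (qmult p q) v) = qmult p (qmult (qmult (qmult q (0, v)) (qcnj q)) (qcnj p))"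
    unfolding qmult_psi[OF qmult_sphere[OF assms], symmetric] qcnj_qmult qmult_assoc ..
  also have "\<dots> = (0, psi p (psi q v))"
    unfolding qmult_psi[OF assms(2)] by (simp only: qmult_psi[OF assms(1), symmetric] qmult_assoc)
  finally show ?thesis by simp
qed

lemma psi_one [simp]: "psi qone v = v"
  by (simp add: psi_eq[OF qone_sphere]) (simp add: qone_def)

lemma psi_cnj:
  assumes "q \<in> sphere 0 1"
  shows "psi (qcnj q) (psi q v) = v" "psi q (psi (qcnj q) v) = v"
  using assms by (simp_all add: psi_qmult[symmetric] qcnj_sphere qmult_cnj)

lemma psi_linear:
  assumes "q \<in> sphere 0 1"
  shows "linear (psi q)"
  by (rule linearI) (simp_all add: psi_eq[OF assms] cross3_simps forall_3)

lemma psi_minus: "q \<in> sphere 0 1 \<Longrightarrow> psi q (- v) = - psi q v"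
  by (rule linear_neg[OF psi_linear])

lemma psi_inner:
  assumes "q \<in> sphere 0 1"
  shows "psi q v \<bullet> psi q w = v \<bullet> w"
proof -
  have "psi q v \<bullet> psi q w = (0 :: real, psi q v) \<bullet> (0, psi q w)"
    by (simp add: inner_quat)
  also have "\<dots> = qmult q (0, v) \<bullet> qmult q (0, w)"
    unfolding qmult_psi_comm[OF assms] inner_qmult_right using assms by (simp add: sphere_quat)
  also have "\<dots> = v \<bullet> w"
    unfolding inner_qmult_left using assms by (simp add: sphere_quat inner_quat)
  finally show ?thesis .
qed

lemma psi_orthogonal: "q \<in> sphere 0 1 \<Longrightarrow> orthogonal_transformation (psi q)"
  by (simp add: orthogonal_transformation_def psi_linear psi_inner)

lemma psi_det:
  assumes q: "q \<in> sphere 0 1"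
  shows "det (matrix (psi q)) = 1"
proof -
  define a b c d where "a = fst q" and "b = snd q $ 1" and "c = snd q $ 2" and "d = snd q $ 3"
  have sq: "snd q = vector [b, c, d]" by (simp add: b_def c_def d_def vec_eq_iff forall_3)
  have 1: "a\<^sup>2 + b\<^sup>2 + c\<^sup>2 + d\<^sup>2 = 1"
    using q unfolding sphere_quat inner_quat
    by (simp add: inner_vec_def sum_3 a_def b_def c_def d_def power2_eq_square)
  have "det (matrix (psi q)) = (a\<^sup>2 + b\<^sup>2 + c\<^sup>2 + d\<^sup>2) ^ 3"
    unfolding det_3 matrix_def psi_eq[OF q] sq a_def[symmetric]
    by (simp add: axis_def inner_vec_def sum_3 cross3_def) algebra
  with 1 show ?thesis by simp
qed

lemma psi_SO3: "q \<in> sphere 0 1 \<Longrightarrow> psi q \<in> SO3"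
  by (simp add: SO3_def psi_orthogonal psi_det)

text \<open>
  For unit quaternions, membership in the rotation group is automatic.
\<close>
lemma mem_Dstar: "q \<in> Dstar \<longleftrightarrow> q \<in> sphere 0 1 \<and> psi q ` dodecahedron = dodecahedron"
  by (auto simp: Dstar_def dodecahedral_group_def psi_SO3)

section \<open>Golden ratio coordinates\<close>

text \<open>
  The golden ratio, as twice the real part of the generator of the spinal ring.
\<close>
definition gold :: real where
  "gold = 2 * cos (pi / 5)"

lemma gold_pos: "0 < gold"
  unfolding gold_def using pi_gt_zero by (intro mult_pos_pos cos_gt_zero_pi) linarith+

lemma gold_sq: "gold * gold = gold + 1"
proof -
  let ?c = "cos (pi / 5)"
  have "cos (3 * (pi / 5)) = cos (pi - 2 * (pi / 5))" by (simp add: field_simps)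
  also have "\<dots> = - cos (2 * (pi / 5))" by (rule cos_pi_minus)
  finally have "4 * ?c ^ 3 - 3 * ?c = - (2 * ?c\<^sup>2 - 1)"
    unfolding cos_treble_cos cos_double_cos .
  then have "(gold + 2) * (gold * gold - gold - 1) = 0"
    unfolding gold_def by (simp add: power2_eq_square power3_eq_cube algebra_simps)
  with gold_pos show ?thesis by simp
qed

lemma gold_sq3: "gold * (gold * z) = gold * z + z"
  using gold_sq by (metis mult.assoc distrib_right mult_1)

lemma gold_gt: "1.6 < gold" "gold < 1.7"
proof -
  have *: "gold * (gold - 1) = 1" using gold_sq by (simp add: algebra_simps)
  then have "1 < gold" using gold_pos zero_less_mult_pos[of gold "gold - 1"] by simp
  show "1.6 < gold"
  proof (rule ccontr)
    assume "\<not> 1.6 < gold"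
    then have "gold * (gold - 1) \<le> 1.6 * 0.6" using \<open>1 < gold\<close> by (intro mult_mono) auto
    with * show False by simp
  qed
  show "gold < 1.7"
  proof (rule ccontr)
    assume "\<not> gold < 1.7"
    then have "gold * (gold - 1) \<ge> 1.7 * 0.7" by (intro mult_mono) auto
    with * show False by simp
  qed
qed

lemma cos_pi_5: "cos (pi / 5) = gold / 2"
  by (simp add: gold_def)

lemma cos_2pi_5: "cos (2 * pi / 5) = (gold - 1) / 2"
  using cos_double_cos[of "pi / 5"] gold_sq by (simp add: cos_pi_5 power2_eq_square)

lemma sin_pi_5_pos: "0 < sin (pi / 5)"
  by (rule sin_gt_zero) simp_all

lemma sin_pi_5_sq: "sin (pi / 5) * sin (pi / 5) = (3 - gold) / 4"
proof -
  have "sin (pi / 5) * sin (pi / 5) = 1 - gold * gold / 4"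
    using sin_squared_eq[of "pi / 5"] by (simp add: cos_pi_5 power2_eq_square)
  then show ?thesis by (simp add: gold_sq field_simps)
qed

lemma sin_2pi_5: "sin (2 * pi / 5) = sin (pi / 5) * gold"
  using sin_double[of "pi / 5"] by (simp add: cos_pi_5)

lemma cos_square_add: "(cos x)\<^sup>2 + (sin x)\<^sup>2 = (1::real)" by simp

lemma sin_x_coord: "sin (pi / 5) * x_coord = 1 / 2"
proof -
  have "sin (pi / 5) * x_coord = gold * gold / (4 * gold) + (gold - 1) / (4 * gold)"
    using sin_pi_5_pos gold_pos
    unfolding x_coord_def cot_def cos_pi_5 cos_2pi_5 sin_2pi_5 by (simp add: field_simps)
  also have "\<dots> = 1 / 2" using gold_pos by (simp add: field_simps gold_sq gold_sq3)
  finally show ?thesis .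
qed

lemma sin_y_coord: "sin (pi / 5) * y_coord = (gold - 1) / 2"
proof -
  have "sin (pi / 5) * y_coord = gold * gold / (4 * gold) - (gold - 1) / (4 * gold)"
    using sin_pi_5_pos gold_pos
    unfolding y_coord_def cot_def cos_pi_5 cos_2pi_5 sin_2pi_5 by (simp add: field_simps)
  also have "\<dots> = (gold - 1) / 2" using gold_pos by (simp add: field_simps gold_sq gold_sq3)
  finally show ?thesis .
qed

lemma x_coord_eq: "x_coord = 1 / (2 * sin (pi / 5))"
  using sin_x_coord sin_pi_5_pos by (simp add: field_simps)

lemma x_coord_pos: "0 < x_coord"
  using sin_pi_5_pos by (simp add: x_coord_eq)

lemma y_coord_eq: "y_coord = (gold - 1) * x_coord"
  using sin_y_coord sin_pi_5_pos by (simp add: x_coord_eq field_simps)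

lemma gold_xy: "gold * x_coord = x_coord + y_coord" "gold * y_coord = x_coord"
proof -
  show "gold * x_coord = x_coord + y_coord" by (simp add: y_coord_eq algebra_simps)
  have "gold * y_coord = (gold * gold - gold) * x_coord" by (simp add: y_coord_eq algebra_simps)
  then show "gold * y_coord = x_coord" by (simp add: gold_sq)
qed

lemma x_coord_sq: "x_coord * x_coord * (3 - gold) = 1"
  using sin_pi_5_sq sin_pi_5_pos gold_gt unfolding x_coord_eq by (simp add: field_simps)

lemma xy_unit: "x_coord * x_coord + y_coord * y_coord = 1"
proof -
  have "x_coord * x_coord + y_coord * y_coord = x_coord * x_coord * (1 + (gold * gold - 2 * gold + 1))"
    by (simp add: y_coord_eq algebra_simps)
  also have "\<dots> = 1" unfolding gold_sq using x_coord_sq by (simp add: algebra_simps)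
  finally show ?thesis .
qed

lemma inradius_pos: "0 < cot (pi / 5) / sqrt 3"
  using gold_pos sin_pi_5_pos by (simp add: cot_def cos_pi_5)

text \<open>
  The imaginary units \<open>f\<close> and \<open>f'\<close>, two adjacent face directions.
\<close>
definition face_f :: "real ^ 3" where "face_f = vector [x_coord, y_coord, 0]"
definition face_f' :: "real ^ 3" where "face_f' = vector [0, x_coord, y_coord]"

text \<open>
  The real powers \<open>q\<^bsup>t\<^esup>\<close> and \<open>q'\<^bsup>t\<^esup>\<close> of the two generators: rotation by the angle \<open>2 t \<pi> / 5\<close>
  about \<open>f\<close> and \<open>f'\<close> respectively.
\<close>
definition circ :: "real \<Rightarrow> quat" where
  "circ t = (cos (t * pi / 5), sin (t * pi / 5) *\<^sub>R face_f)"
definition circ' :: "real \<Rightarrow> quat" where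
  "circ' t = (cos (t * pi / 5), sin (t * pi / 5) *\<^sub>R face_f')"

lemma face_norm: "face_f \<bullet> face_f = 1" "face_f' \<bullet> face_f' = 1"
  using xy_unit by (simp_all add: face_f_def face_f'_def inner_vec_def sum_3)

lemma circ_mult:
  assumes "u \<bullet> u = 1"
  shows "qmult (cos s, sin s *\<^sub>R u) (cos t, sin t *\<^sub>R u) = (cos (s + t), sin (s + t) *\<^sub>R u)"
  using assms by (simp add: qmult_def cos_add sin_add cross_mult_left cross_mult_right algebra_simps)

lemma circ_add: "qmult (circ s) (circ t) = circ (s + t)" "qmult (circ' s) (circ' t) = circ' (s + t)"
  using circ_mult[OF face_norm(1), of "s * pi / 5" "t * pi / 5"]
    circ_mult[OF face_norm(2), of "s * pi / 5" "t * pi / 5"]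
  by (simp_all add: circ_def circ'_def add_divide_distrib distrib_right)

lemma circ_sphere: "circ t \<in> sphere 0 1" "circ' t \<in> sphere 0 1"
  by (simp_all add: sphere_quat inner_quat circ_def circ'_def face_norm flip: power2_eq_square)

lemma circ_cnj: "qcnj (circ t) = circ (- t)" "qcnj (circ' t) = circ' (- t)"
  by (simp_all add: qcnj_def circ_def circ'_def)

lemma circ_0: "circ 0 = qone" "circ' 0 = qone"
  by (simp_all add: circ_def circ'_def qone_def)

lemma ring_gen_circ: "ring_gen = circ 1" "ring_gen' = circ' 1"
  by (simp_all add: ring_gen_def ring_gen'_def circ_def circ'_def face_f_def face_f'_def)

lemma circ_period: "circ (t + 10) = circ t"
proof -
  have "(t + 10) * pi / 5 = t * pi / 5 + 2 * pi" by (simp add: field_simps)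
  then show ?thesis by (simp only: circ_def sin_periodic cos_periodic)
qed

lemma circ_1: "circ 1 = (gold / 2, vector [1 / 2, (gold - 1) / 2, 0])"
  "circ' 1 = (gold / 2, vector [0, 1 / 2, (gold - 1) / 2])"
  by (simp_all add: circ_def circ'_def cos_pi_5 face_f_def face_f'_def vec_eq_iff forall_3
      sin_x_coord sin_y_coord)

lemma circ_pow: "ring_gen [^]\<^bsub>S3\<^esub> (n :: nat) = circ (real n)"
  by (induction n) (simp_all add: circ_0 ring_gen_circ circ_add add.commute)

lemma rotation_coeff:
  "gold * gold / 4 - (1 / 4 + (gold - 1) * (gold - 1) / 4) = (gold - 1) / 2"
  "gold * ((gold - 1) * z) = z"
proof -
  show "gold * gold / 4 - (1 / 4 + (gold - 1) * (gold - 1) / 4) = (gold - 1) / 2" by (simp add: field_simps)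
  have "gold * ((gold - 1) * z) = (gold * gold - gold) * z" by (simp add: algebra_simps)
  then show "gold * ((gold - 1) * z) = z" by (simp add: gold_sq)
qed

lemma psi_circ_1:
  "psi (circ 1) (vector [a, b, d]) = (1 / 2) *\<^sub>R
     vector [gold * a + gold * b - b + d, gold * a - a + b - gold * d, - a + gold * b + gold * d - d]"
  unfolding psi_eq[OF circ_sphere(1)]
  by (simp add: circ_1 inner_vec_def sum_3 cross3_def vec_eq_iff forall_3 power2_eq_square
      rotation_coeff)
    (intro conjI; simp add: field_simps; simp add: gold_sq3)

lemma psi_circ'_1:
  "psi (circ' 1) (vector [a, b, d]) = (1 / 2) *\<^sub>R
     vector [gold * a - a - b + gold * d, a + gold * b + gold * d - d, - gold * a + gold * b - b + d]"
  unfolding psi_eq[OF circ_sphere(2)]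
  by (simp add: circ_1 inner_vec_def sum_3 cross3_def vec_eq_iff forall_3 power2_eq_square
      rotation_coeff)
    (intro conjI; simp add: field_simps; simp add: gold_sq3)

section \<open>The action on face directions\<close>

text \<open>
  The five face directions adjacent to \<open>f\<close>, in the cyclic order in which \<open>\<psi>(q)\<close> permutes them; the
  index is read modulo 5. Together with \<open>f\<close> and the antipodes they are all twelve.
\<close>
definition nbr :: "nat \<Rightarrow> real ^ 3" where
  "nbr k =
    (if k mod 5 = 0 then vector [0, x_coord, y_coord]
     else if k mod 5 = 1 then vector [y_coord, 0, x_coord]
     else if k mod 5 = 2 then vector [x_coord, - y_coord, 0]
     else if k mod 5 = 3 then vector [y_coord, 0, - x_coord]
     else vector [0, x_coord, - y_coord])"

lemma nbr_simps:
  "nbr 0 = vector [0, x_coord, y_coord]" "nbr 1 = vector [y_coord, 0, x_coord]"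
  "nbr (Suc 0) = vector [y_coord, 0, x_coord]"
  "nbr 2 = vector [x_coord, - y_coord, 0]" "nbr 3 = vector [y_coord, 0, - x_coord]"
  "nbr 4 = vector [0, x_coord, - y_coord]"
  by (simp_all add: nbr_def)

lemma nbr_mod: "nbr (k mod 5) = nbr k"
  by (simp add: nbr_def)

lemma less_5: "(k :: nat) mod 5 \<in> {0, 1, 2, 3, 4}"
  by (simp, arith)

lemma face_directions_eq:
  "face_directions = {face_f, - face_f} \<union> (\<Union>k\<in>{0, 1, 2, 3, 4}. {nbr k, - nbr k})"
proof -
  have neg: "- vector [a, b, d] = (vector [- a, - b, - d] :: real ^ 3)" for a b d
    by (simp add: vec_eq_iff forall_3)
  show ?thesis
    unfolding face_directions_def by (intro equalityI; simp add: nbr_simps face_f_def neg)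
qed

lemma psi_circ_face_f: "psi (circ t) face_f = face_f"
proof -
  have "psi (circ t) face_f = ((cos (t * pi / 5))\<^sup>2 + (sin (t * pi / 5))\<^sup>2) *\<^sub>R face_f"
    unfolding psi_eq[OF circ_sphere(1)]
    by (simp add: circ_def face_norm cross_mult_left power2_eq_square flip: scaleR_add_left)
      (simp add: add.commute)
  then show ?thesis unfolding cos_square_add by simp
qed

lemma psi_circ_1_nbr: "psi (circ 1) (nbr k) = nbr (k + 1)"
proof -
  have step: "psi (circ 1) (nbr 0) = nbr 1" "psi (circ 1) (nbr 1) = nbr 2"
    "psi (circ 1) (nbr 2) = nbr 3" "psi (circ 1) (nbr 3) = nbr 4" "psi (circ 1) (nbr 4) = nbr 0"
    by (simp_all add: nbr_simps psi_circ_1 vec_eq_iff forall_3 gold_xy)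
  have "psi (circ 1) (nbr (k mod 5)) = nbr ((k mod 5 + 1) mod 5)"
    using less_5[of k]
  proof (elim insertE emptyE)
    assume "k mod 5 = 0" then show ?thesis using step by simp
  next
    assume "k mod 5 = 1" then show ?thesis using step by (simp add: numeral_2_eq_2)
  next
    assume "k mod 5 = 2" then show ?thesis using step by simp
  next
    assume "k mod 5 = 3" then show ?thesis using step by simp
  next
    assume "k mod 5 = 4" then show ?thesis using step by simp
  qed
  then show ?thesis by (simp add: nbr_mod mod_Suc_eq)
qed

lemma psi_circ_nbr: "psi (circ (real n)) (nbr k) = nbr (k + n)"
proof (induction n)
  case 0
  then show ?case by (simp add: circ_0)
next
  case (Suc n)
  have "circ (real (Suc n)) = qmult (circ 1) (circ (real n))" by (simp add: circ_add)
  with Suc show ?case by (simp add: psi_qmult circ_sphere psi_circ_1_nbr)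
qed

lemma psi_circ'_1_faces:
  "psi (circ' 1) face_f = nbr 4"
  "psi (circ' 1) (nbr 0) = nbr 0"  "psi (circ' 1) (nbr 1) = face_f"
  "psi (circ' 1) (nbr 2) = nbr 3" "psi (circ' 1) (nbr 3) = - nbr 1" 
  "psi (circ' 1) (nbr 4) = - nbr 2"
  by (simp_all add: nbr_simps face_f_def psi_circ'_1 vec_eq_iff forall_3 gold_xy)

lemma face_cases:
  assumes "n \<in> face_directions"
  obtains "n = face_f" | "n = - face_f" | k where "k < 5" "n = nbr k" | k where "k < 5" "n = - nbr k"
proof -
  obtain K :: "nat set" where K: "K = {0, 1, 2, 3, 4}" by blast
  then have less: "k < 5" if "k \<in> K" for k using that by auto
  from assms have "n = face_f \<or> n = - face_f \<or> (\<exists>k\<in>K. n = nbr k) \<or> (\<exists>k\<in>K. n = - nbr k)"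
    unfolding face_directions_eq K[symmetric] by blast
  with less that show thesis by metis
qed

lemma face_f_nbr: "face_f \<bullet> nbr k = x_coord * y_coord"
proof -
  have xx: "x_coord * x_coord - y_coord * y_coord = x_coord * y_coord"
  proof -
    have "y_coord * y_coord = (gold * y_coord - y_coord) * x_coord"
      by (simp add: y_coord_eq algebra_simps)
    then show ?thesis unfolding gold_xy by (simp add: algebra_simps)
  qed
  have "face_f \<bullet> nbr j = x_coord * y_coord" if "j \<in> {0, 1, 2, 3, 4}" for j
    using that
    by (elim insertE emptyE) (simp_all add: face_f_def nbr_simps inner_vec_def sum_3 mult.commute xx)
  from this[OF less_5, of k] show ?thesis by (simp add: nbr_mod)
qed

lemma xy_bounds: "0 < x_coord * y_coord" "x_coord * y_coord < 1"
proof -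
  show pos: "0 < x_coord * y_coord"
    using x_coord_pos gold_gt by (simp add: y_coord_eq)
  have "0 \<le> (x_coord - y_coord)\<^sup>2" by simp
  then have "2 * (x_coord * y_coord) \<le> 1"
    using xy_unit by (simp add: power2_eq_square algebra_simps)
  with pos show "x_coord * y_coord < 1" by simp
qed

lemma nbr_in_faces: "nbr k \<in> face_directions" "- nbr k \<in> face_directions"
proof -
  have "nbr (k mod 5) \<in> face_directions" "- nbr (k mod 5) \<in> face_directions"
    unfolding face_directions_eq by (rule UnI2, rule UN_I[OF less_5[of k]], simp)+
  then show "nbr k \<in> face_directions" "- nbr k \<in> face_directions" by (simp_all add: nbr_mod)
qed

lemma face_f_in_faces: "face_f \<in> face_directions" "- face_f \<in> face_directions"
  unfolding face_directions_eq by simp_all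

lemma face_f'_nbr: "face_f' = nbr 0"
  by (simp add: face_f'_def nbr_simps)

lemma uminus_face: "n \<in> face_directions \<Longrightarrow> - n \<in> face_directions"
  by (erule face_cases) (simp_all add: nbr_in_faces face_f_in_faces)

lemma face_unit:
  assumes "n \<in> face_directions"
  shows "n \<bullet> n = 1"
proof -
  have "nbr k \<bullet> nbr k = nbr 0 \<bullet> nbr 0" for k
    using psi_inner[OF circ_sphere(1), of "real k" "nbr 0" "nbr 0"] by (simp add: psi_circ_nbr)
  moreover have "nbr 0 \<bullet> nbr 0 = 1" using face_norm(2) by (simp add: face_f'_nbr)
  ultimately show ?thesis using assms face_norm(1) by (auto elim!: face_cases)
qed

lemma finite_faces: "finite face_directions"
  unfolding face_directions_eq by simp

text \<open>
  A unit vector is a face direction exactly if the dodecahedron lies in the half-space that it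
  bounds at the inradius. This describes the face directions by the solid alone, so that every
  isometry preserving the dodecahedron permutes them.
\<close>
lemma face_directions_support:
  "u \<in> face_directions \<longleftrightarrow> u \<bullet> u = 1 \<and> (\<forall>v\<in>dodecahedron. u \<bullet> v \<le> cot (pi / 5) / sqrt 3)"
proof
  assume "u \<in> face_directions"
  then show "u \<bullet> u = 1 \<and> (\<forall>v\<in>dodecahedron. u \<bullet> v \<le> cot (pi / 5) / sqrt 3)"
    by (auto simp: face_unit dodecahedron_def)
next
  define r where "r = cot (pi / 5) / sqrt 3"
  assume u: "u \<bullet> u = 1 \<and> (\<forall>v\<in>dodecahedron. u \<bullet> v \<le> cot (pi / 5) / sqrt 3)"
  show "u \<in> face_directions"
  proof (rule ccontr)
    assume no: "u \<notin> face_directions"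
    define M where "M = max (1 / 2) (Max ((\<lambda>n. n \<bullet> u) ` face_directions))"
    have "n \<bullet> u < 1" if n: "n \<in> face_directions" for n
    proof -
      have "0 < (n - u) \<bullet> (n - u)" using n no by auto
      then show ?thesis using face_unit[OF n] u by (simp add: inner_diff inner_commute)
    qed
    moreover have "face_directions \<noteq> {}" using face_f_in_faces by blast
    ultimately have M: "1 / 2 \<le> M" "M < 1"
      using finite_faces by (auto simp: M_def)
    have le: "n \<bullet> u \<le> M" if "n \<in> face_directions" for n
      unfolding M_def using that finite_faces by (intro max.coboundedI2 Max_ge) auto
    \<comment> \<open>If \<open>u\<close> is not a face direction, the ray through \<open>u\<close> leaves the solid only beyond distance \<open>r\<close>.\<close>
    have "(r / M) *\<^sub>R u \<in> dodecahedron"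
      unfolding dodecahedron_def r_def[symmetric]
    proof (clarify)
      fix n assume "n \<in> face_directions"
      from le[OF this] show "n \<bullet> ((r / M) *\<^sub>R u) \<le> r"
        using M inradius_pos by (simp add: r_def[symmetric] field_simps)
    qed
    with u have "r / M \<le> r" by (auto simp: r_def[symmetric])
    then show False using M inradius_pos by (simp add: r_def[symmetric] field_simps)
  qed
qed

lemma mem_Dstar_faces:
  "q \<in> Dstar \<longleftrightarrow> q \<in> sphere 0 1 \<and> (\<forall>n\<in>face_directions. psi q n \<in> face_directions)"
proof
  assume "q \<in> Dstar"
  then have q: "q \<in> sphere 0 1" and im: "psi q ` dodecahedron = dodecahedron"
    by (auto simp: mem_Dstar)
  have "psi q n \<in> face_directions" if n: "n \<in> face_directions" for n
    unfolding face_directions_support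
  proof (intro conjI ballI)
    show "psi q n \<bullet> psi q n = 1" using face_unit[OF n] by (simp add: psi_inner[OF q])
    fix v assume "v \<in> dodecahedron"
    then obtain w where "w \<in> dodecahedron" "v = psi q w" using im by blast
    with n show "psi q n \<bullet> v \<le> cot (pi / 5) / sqrt 3"
      by (auto simp: psi_inner[OF q] dodecahedron_def)
  qed
  with q show "q \<in> sphere 0 1 \<and> (\<forall>n\<in>face_directions. psi q n \<in> face_directions)" by blast
next
  assume *: "q \<in> sphere 0 1 \<and> (\<forall>n\<in>face_directions. psi q n \<in> face_directions)"
  then have q: "q \<in> sphere 0 1" by blast
  have inj: "inj (psi q)" by (rule orthogonal_transformation_inj[OF psi_orthogonal[OF q]])
  have onto: "psi q ` face_directions = face_directions"
    by (rule endo_inj_surj[OF finite_faces]) (use * inj in \<open>auto intro: inj_on_subset\<close>)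
  have iff: "psi q v \<in> dodecahedron \<longleftrightarrow> v \<in> dodecahedron" for v
    unfolding dodecahedron_def mem_Collect_eq by (subst onto[symmetric]) (simp add: psi_inner[OF q])
  have "psi q ` dodecahedron = dodecahedron"
  proof
    show "psi q ` dodecahedron \<subseteq> dodecahedron" using iff by blast
    show "dodecahedron \<subseteq> psi q ` dodecahedron"
    proof
      fix v assume "v \<in> dodecahedron"
      then have "psi (qcnj q) v \<in> dodecahedron" using iff[of "psi (qcnj q) v"] by (simp add: psi_cnj[OF q])
      then show "v \<in> psi q ` dodecahedron" by (rule rev_image_eqI) (simp add: psi_cnj[OF q])
    qed
  qed
  with q show "q \<in> Dstar" by (simp add: mem_Dstar)
qed

lemma Dstar_sphere: "q \<in> Dstar \<Longrightarrow> q \<in> sphere 0 1"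
  by (simp add: mem_Dstar)

lemma Dstar_face: "q \<in> Dstar \<Longrightarrow> n \<in> face_directions \<Longrightarrow> psi q n \<in> face_directions"
  by (simp add: mem_Dstar_faces)

lemma Dstar_qmult: "p \<in> Dstar \<Longrightarrow> q \<in> Dstar \<Longrightarrow> qmult p q \<in> Dstar"
  by (simp add: mem_Dstar_faces qmult_sphere psi_qmult)

lemma Dstar_qcnj:
  assumes "q \<in> Dstar"
  shows "qcnj q \<in> Dstar"
proof -
  have q: "q \<in> sphere 0 1" and im: "psi q ` dodecahedron = dodecahedron"
    using assms by (auto simp: mem_Dstar)
  have "psi (qcnj q) ` psi q ` dodecahedron = dodecahedron"
    by (simp add: image_image psi_cnj[OF q])
  with q im show ?thesis by (simp add: mem_Dstar qcnj_sphere)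
qed

lemma qone_Dstar: "qone \<in> Dstar"
  by (simp add: mem_Dstar qone_sphere)

lemma uminus_Dstar:
  assumes "q \<in> Dstar"
  shows "- q \<in> Dstar"
proof -
  have q: "q \<in> sphere 0 1" "- q \<in> sphere 0 1"
    using Dstar_sphere[OF assms] by (simp_all add: sphere_quat)
  have "psi (- q) = psi q"
    by (rule ext) (simp add: psi_eq[OF q(1)] psi_eq[OF q(2)] cross_minus_left)
  with assms q show ?thesis by (simp add: mem_Dstar_faces)
qed

lemma circ_1_Dstar: "circ 1 \<in> Dstar"
  unfolding mem_Dstar_faces
  by (auto simp: circ_sphere psi_circ_face_f psi_circ_1_nbr psi_minus nbr_in_faces face_f_in_faces
      elim!: face_cases)

lemma circ'_1_Dstar: "circ' 1 \<in> Dstar"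
  unfolding mem_Dstar_faces
proof (intro conjI ballI)
  have nb: "psi (circ' 1) (nbr k) \<in> face_directions \<and> - psi (circ' 1) (nbr k) \<in> face_directions"
    if "k < 5" for k
  proof -
    from that have "k \<in> {0, 1, 2, 3, 4}" by auto
    then show ?thesis
      by (elim insertE emptyE)
        (simp_all only: psi_circ'_1_faces nbr_in_faces face_f_in_faces minus_minus simp_thms)
  qed
  fix n assume "n \<in> face_directions"
  then show "psi (circ' 1) n \<in> face_directions"
    using nb by (auto simp: psi_circ'_1_faces(1) psi_minus circ_sphere nbr_in_faces elim!: face_cases)
qed (rule circ_sphere)

lemma circ_Dstar: "circ (real n) \<in> Dstar" "circ (- real n) \<in> Dstar"
proof -
  show "circ (real n) \<in> Dstar"
  proof (induction n)
    case (Suc n)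
    have "circ (real (Suc n)) = qmult (circ 1) (circ (real n))" by (simp add: circ_add)
    with Suc show ?case by (simp add: Dstar_qmult circ_1_Dstar)
  qed (simp add: circ_0 qone_Dstar)
  from Dstar_qcnj[OF this] show "circ (- real n) \<in> Dstar" by (simp add: circ_cnj)
qed

lemma circ'_Dstar: "c \<in> {1, 2} \<Longrightarrow> circ' c \<in> Dstar" "c \<in> {1, 2} \<Longrightarrow> circ' (- c) \<in> Dstar"
proof -
  have "circ' 2 \<in> Dstar"
    using Dstar_qmult[OF circ'_1_Dstar circ'_1_Dstar] by (simp add: circ_add)
  then show "c \<in> {1, 2} \<Longrightarrow> circ' c \<in> Dstar"
    using circ'_1_Dstar by auto
  then show "c \<in> {1, 2} \<Longrightarrow> circ' (- c) \<in> Dstar"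
    using Dstar_qcnj[of "circ' c"] by (simp add: circ_cnj)
qed

lemma psi_fixed_cross:
  assumes "q \<in> sphere 0 1" "psi q v = v"
  shows "cross3 (snd q) v = 0"
proof -
  have "snd (qmult q (0, v)) = snd (qmult (0, v) q)"
    using qmult_psi_comm[OF assms(1), of v] assms(2) by simp
  then have "cross3 (snd q) v = cross3 v (snd q)" by (simp add: qmult_def)
  then have "cross3 (snd q) v = - cross3 (snd q) v" by (metis cross_skew)
  then have "2 *\<^sub>R cross3 (snd q) v = 0" unfolding eq_neg_iff_add_eq_0 scaleR_2 .
  then show ?thesis by simp
qed

lemma circ_5: "circ 5 = - qone"
  by (simp add: circ_def qone_def)

section \<open>Cosets of the spinal ring\<close>

text \<open>
  An element fixing \<open>f\<close> permutes the five neighbours of \<open>f\<close>. Composed with a power of \<open>q\<close> it also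
  fixes \<open>nbr 0\<close>; its axis is then parallel to two independent vectors, so it is \<open>1\<close> or \<open>-1 = q\<^bsup>5\<^esup>\<close>.
\<close>
lemma stabiliser_face_f:
  assumes q: "q \<in> Dstar" and fix_f: "psi q face_f = face_f"
  shows "\<exists>n. q = circ (real n)"
proof -
  note qs = Dstar_sphere[OF q]
  have "psi q (nbr 0) \<in> face_directions" by (rule Dstar_face[OF q nbr_in_faces(1)])
  moreover have ip: "face_f \<bullet> psi q (nbr 0) = x_coord * y_coord"
    using psi_inner[OF qs, of face_f "nbr 0"] by (simp add: fix_f face_f_nbr)
  ultimately obtain k where k: "psi q (nbr 0) = nbr k"
    using xy_bounds by (auto simp: face_norm face_f_nbr elim!: face_cases)
  define h where "h = qmult (circ (- real k)) q"
  have hs: "h \<in> sphere 0 1" by (simp add: h_def qmult_sphere circ_sphere qs)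
  have "psi h face_f = face_f" by (simp add: h_def psi_qmult circ_sphere qs fix_f psi_circ_face_f)
  from psi_fixed_cross[OF hs this] have 1: "cross3 (snd h) face_f = 0" .
  have "psi h (nbr 0) = psi (qcnj (circ (real k))) (psi (circ (real k)) (nbr 0))"
    by (simp add: h_def psi_qmult circ_sphere qs k psi_circ_nbr circ_cnj)
  then have "psi h (nbr 0) = nbr 0" by (simp add: psi_cnj[OF circ_sphere(1)])
  from psi_fixed_cross[OF hs this] have 2: "cross3 (snd h) (nbr 0) = 0" .
  have "snd h = 0"
    using 1 2 x_coord_pos gold_gt
    by (auto simp: face_f_def nbr_simps cross3_def vec_eq_iff forall_3 y_coord_eq)
  moreover from this have "fst h * fst h = 1" using hs by (simp add: sphere_quat inner_quat)
  ultimately have "h = circ 0 \<or> h = circ 5"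
    by (auto simp: circ_0 circ_5 qone_def prod_eq_iff square_eq_1_iff)
  moreover have "q = qmult (circ (real k)) h"
    by (simp add: h_def circ_add circ_0 flip: qmult_assoc)
  ultimately have "q = circ (real k) \<or> q = circ (real (k + 5))" by (auto simp: circ_add)
  then show ?thesis by blast
qed

lemma circ_mod: "circ (real (n mod 10)) = circ (real n)"
proof -
  have "circ (real (m + 10 * k)) = circ (real m)" for m k
  proof (induction k)
    case (Suc k)
    have "real (m + 10 * Suc k) = real (m + 10 * k) + 10" by simp
    then show ?case using Suc by (simp only: circ_period)
  qed simp
  from this[of "n mod 10" "n div 10"] show ?thesis by (simp add: mult.commute)
qed

text \<open>
  The elements \<open>q\<^bsup>j+t\<^esup> q'\<^bsup>c\<^esup> q\<^bsup>-j\<^esup>\<close>, which run through the inner rings for \<open>c = 1\<close> and through the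
  outer rings for \<open>c = 2\<close>. Shifting the first exponent by \<open>j\<close> makes the element a conjugate of
  \<open>q\<^bsup>t\<^esup> q'\<^bsup>c\<^esup>\<close>, so that its real part does not depend on \<open>j\<close>.
\<close>
definition ring_cell :: "real \<Rightarrow> real \<Rightarrow> real \<Rightarrow> quat" where
  "ring_cell c j t = qmult (circ (j + t)) (qmult (circ' c) (circ (- j)))"

lemma fst_ring_cell: "fst (ring_cell c j t) = fst (qmult (circ t) (circ' c))"
proof -
  have comm: "fst (qmult p q) = fst (qmult q p)" for p q by (simp add: qmult_def inner_commute)
  have "fst (ring_cell c j t) = fst (qmult (qmult (circ (- j)) (circ (j + t))) (circ' c))"
    unfolding ring_cell_def by (subst comm) (simp add: qmult_assoc, subst comm, simp add: qmult_assoc)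
  then show ?thesis by (simp add: circ_add)
qed

lemma face_flip_fst_zero:
  assumes g: "g \<in> sphere 0 1" and flip: "psi (qcnj g) face_f = - face_f"
  shows "fst (qmult (circ t) g) = 0"
proof -
  have "face_f = - psi g face_f"
    using psi_cnj(2)[OF g, of face_f] by (simp add: flip psi_minus g)
  then have "psi g face_f = - face_f" by (metis minus_minus)
  with qmult_psi_comm[OF g, of face_f] have *: "qmult g (0, face_f) = qmult (0, - face_f) g" by simp
  from arg_cong[OF *, of fst] have 1: "snd g \<bullet> face_f = 0"
    by (simp add: qmult_def inner_commute)
  from arg_cong[OF *, of snd] have "fst g *\<^sub>R face_f = - (fst g *\<^sub>R face_f)"
    using cross_skew[of face_f "snd g"] by (simp add: qmult_def cross_minus_left)
  from arg_cong[OF this, of "\<lambda>v. v \<bullet> face_f"] have "fst g = 0" by (simp add: face_norm)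
  with 1 show ?thesis by (simp add: qmult_def circ_def inner_commute)
qed

lemma psi_circ'_neg_1: "psi (circ' (- 1)) face_f = nbr 1"
  using psi_cnj(1)[OF circ_sphere(2), of 1 "nbr 1"] by (simp only: psi_circ'_1_faces circ_cnj)

text \<open>
  The coset of \<open>g\<close> is read off from \<open>\<psi>(g\<inverse>) f\<close>. If this direction is \<open>\<psi>(q\<^bsup>j\<^esup> q'\<^bsup>-c\<^esup>) f\<close>, then
  \<open>g q\<^bsup>j\<^esup> q'\<^bsup>-c\<^esup>\<close> fixes \<open>f\<close> and hence is a power of \<open>q\<close>. If it is \<open>- f\<close>, the whole coset
  has real part 0.
\<close>
lemma Dstar_cases:
  assumes g: "g \<in> Dstar"
  obtains (spinal) n where "n < 10" "g = circ (real n)"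
  | (equatorial) "\<And>t. fst (qmult (circ t) g) = 0"
  | (skew) c j n where "c \<in> {1, 2}" "j < 5" "n < 10" "g = ring_cell c (real j) (real n)"
proof -
  note gs = Dstar_sphere[OF g]
  define n where "n = psi (qcnj g) face_f"
  have gn: "psi g n = face_f" by (simp add: n_def psi_cnj[OF gs])
  have "n \<in> face_directions" unfolding n_def by (intro Dstar_face Dstar_qcnj g face_f_in_faces)
  have key: thesis if c: "c \<in> {1, 2}" and j: "j < 5"
    and n: "n = psi (circ (real j)) (psi (circ' (- c)) face_f)" for c j
  proof -
    define h where "h = qmult g (qmult (circ (real j)) (circ' (- c)))"
    have "h \<in> Dstar" unfolding h_def using c by (intro Dstar_qmult g circ_Dstar circ'_Dstar)
    moreover have "psi h face_f = face_f"
      using gn by (simp add: h_def psi_qmult gs circ_sphere qmult_sphere n)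
    ultimately obtain m where m: "h = circ (real m)" using stabiliser_face_f by blast
    have "qmult h (qmult (circ' c) (circ (- real j))) = g"
      unfolding h_def
      by (simp add: qmult_assoc)
        (simp add: circ_add circ_0 flip: qmult_assoc[of "circ' (- c)"] qmult_assoc[of "circ (real j)"])
    moreover have "circ (real m) = circ (real j + real ((m + 10 - j) mod 10))"
    proof -
      have "(j + (m + 10 - j) mod 10) mod 10 = m mod 10"
        using j by (simp add: mod_add_right_eq)
      then have "circ (real m) = circ (real (j + (m + 10 - j) mod 10))" by (metis circ_mod)
      then show ?thesis by simp
    qed
    ultimately have "g = ring_cell c (real j) (real ((m + 10 - j) mod 10))"
      by (simp add: ring_cell_def m)
    with skew[OF c j, of "(m + 10 - j) mod 10"] show thesis by simp
  qed
  have n2: "psi (circ' (- 2)) face_f = - nbr 3"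
  proof -
    have "psi (circ' 2) (- nbr 3) = psi (circ' 1) (psi (circ' 1) (- nbr 3))"
      by (simp add: circ_sphere circ_add flip: psi_qmult)
    also have "\<dots> = face_f" by (simp only: psi_minus[OF circ_sphere(2)] psi_circ'_1_faces minus_minus)
    finally show ?thesis using psi_cnj(1)[OF circ_sphere(2), of 2 "- nbr 3"] by (simp only: circ_cnj)
  qed
  from \<open>n \<in> face_directions\<close> show thesis
  proof (cases rule: face_cases)
    case 1
    with gn have "psi g face_f = face_f" by simp
    with stabiliser_face_f[OF g] obtain m where "g = circ (real m)" by blast
    then show thesis using spinal[of "m mod 10"] by (simp add: circ_mod)
  next
    case 2
    show thesis by (rule equatorial, rule face_flip_fst_zero[OF gs]) (use 2 in \<open>simp add: n_def\<close>)
  next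
    case (3 k)
    have "nbr (1 + (k + 4) mod 5) = nbr k"
    proof -
      have "(1 + (k + 4) mod 5) mod 5 = k mod 5" by presburger
      then show ?thesis by (metis nbr_mod)
    qed
    then show thesis
      using key[of 1 "(k + 4) mod 5"] 3 by (simp only: psi_circ'_neg_1 psi_circ_nbr) simp
  next
    case (4 k)
    have "nbr (3 + (k + 2) mod 5) = nbr k"
    proof -
      have "(3 + (k + 2) mod 5) mod 5 = k mod 5" by presburger
      then show ?thesis by (metis nbr_mod)
    qed
    then show thesis
      using key[of 2 "(k + 2) mod 5"] 4 by (simp only: n2 psi_minus[OF circ_sphere(1)] psi_circ_nbr) simp
  qed
qed

section \<open>Layers of the tiling\<close>

lemma fst_circ_step:
  "fst (qmult (circ (t + 2)) g) = gold * fst (qmult (circ (t + 1)) g) - fst (qmult (circ t) g)"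
proof -
  define s where "s = (t + 1) * pi / 5"
  have s: "(t + 2) * pi / 5 = s + pi / 5" "t * pi / 5 = s - pi / 5"
    by (simp_all add: s_def field_simps)
  show ?thesis
    unfolding qmult_def circ_def s s_def[symmetric]
    by (simp add: cos_add cos_diff sin_add sin_diff gold_def algebra_simps)
qed

lemma fst_circ_values:
  fixes g :: quat
  defines "h \<equiv> \<lambda>t. fst (qmult (circ t) g)"
  shows "h 0 = fst g" "h 2 = gold * h 1 - fst g" "h 3 = gold * (h 1 - fst g)"
    "h 4 = h 1 - gold * fst g" "h 5 = - fst g" "h 6 = - h 1" "h 7 = - (gold * h 1 - fst g)"
    "h 8 = - (gold * (h 1 - fst g))" "h 9 = - (h 1 - gold * fst g)"
proof -
  have step: "h (t + 2) = gold * h (t + 1) - h t" for t unfolding h_def by (rule fst_circ_step)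
  show 0: "h 0 = fst g" by (simp add: h_def circ_0)
  show 2: "h 2 = gold * h 1 - fst g" using step[of 0] by (simp add: 0)
  show 3: "h 3 = gold * (h 1 - fst g)" using step[of 1] by (simp add: 2 algebra_simps gold_sq3)
  show 4: "h 4 = h 1 - gold * fst g" using step[of 2] by (simp add: 2 3 algebra_simps gold_sq3)
  show 5: "h 5 = - fst g" using step[of 3] by (simp add: 3 4 algebra_simps gold_sq3)
  show 6: "h 6 = - h 1" using step[of 4] by (simp add: 4 5 algebra_simps gold_sq3)
  show 7: "h 7 = - (gold * h 1 - fst g)" using step[of 5] by (simp add: 5 6 algebra_simps gold_sq3)
  show 8: "h 8 = - (gold * (h 1 - fst g))" using step[of 6] by (simp add: 6 7 algebra_simps gold_sq3)
  show 9: "h 9 = - (h 1 - gold * fst g)" using step[of 7] by (simp add: 7 8 algebra_simps gold_sq3)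
qed

lemma circ'_2: "circ' 2 = ((gold - 1) / 2, gold *\<^sub>R vector [0, 1 / 2, (gold - 1) / 2])"
proof -
  have "sin (2 * pi / 5) *\<^sub>R face_f' = gold *\<^sub>R (sin (pi / 5) *\<^sub>R face_f')" by (simp add: sin_2pi_5)
  moreover have "sin (pi / 5) *\<^sub>R face_f' = vector [0, 1 / 2, (gold - 1) / 2]"
    using circ_1(2) by (simp add: circ'_def)
  ultimately show ?thesis by (simp add: circ'_def cos_2pi_5)
qed

lemma fst_circ_circ':
  "fst (circ 1) = gold / 2"
  "fst (circ' 1) = gold / 2" "fst (qmult (circ 1) (circ' 1)) = 1 / 2"
  "fst (circ' 2) = (gold - 1) / 2" "fst (qmult (circ 1) (circ' 2)) = 0"
proof -
  show "fst (circ 1) = gold / 2" "fst (circ' 1) = gold / 2" by (simp_all add: circ_1)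
  show "fst (circ' 2) = (gold - 1) / 2" by (simp add: circ'_2)
  show "fst (qmult (circ 1) (circ' 1)) = 1 / 2"
    by (simp add: circ_1 qmult_def inner_vec_def sum_3 gold_sq field_simps)
  show "fst (qmult (circ 1) (circ' 2)) = 0"
    by (simp add: circ_1 circ'_2 qmult_def inner_vec_def sum_3)
qed

lemma fst_qone [simp]: "fst qone = 1"
  by (simp add: qone_def)

lemma fst_spinal:
  "fst (circ 0) = 1" "fst (circ 2) = (gold - 1) / 2" "fst (circ 3) = - (gold - 1) / 2"
  "fst (circ 4) = - gold / 2" "fst (circ 5) = - 1" "fst (circ 6) = - gold / 2"
  "fst (circ 7) = - (gold - 1) / 2" "fst (circ 8) = (gold - 1) / 2" "fst (circ 9) = gold / 2"
  unfolding fst_circ_values[of qone, unfolded qmult_one fst_qone fst_circ_circ'(1)]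
  using gold_sq by (simp_all add: field_simps)

lemma fst_inner:
  "fst (ring_cell 1 j 0) = gold / 2" "fst (ring_cell 1 j 1) = 1 / 2" "fst (ring_cell 1 j 2) = 0"
  "fst (ring_cell 1 j 3) = - 1 / 2" "fst (ring_cell 1 j 4) = - gold / 2" "fst (ring_cell 1 j 5) = - gold / 2"
  "fst (ring_cell 1 j 6) = - 1 / 2" "fst (ring_cell 1 j 7) = 0" "fst (ring_cell 1 j 8) = 1 / 2"
  "fst (ring_cell 1 j 9) = gold / 2"
  unfolding fst_ring_cell fst_circ_values[of "circ' 1"] fst_circ_circ'
  using gold_sq by (simp_all add: field_simps)

lemma fst_outer:
  "fst (ring_cell 2 j 0) = (gold - 1) / 2" "fst (ring_cell 2 j 1) = 0" "fst (ring_cell 2 j 2) = - (gold - 1) / 2"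
  "fst (ring_cell 2 j 3) = - 1 / 2" "fst (ring_cell 2 j 4) = - 1 / 2" "fst (ring_cell 2 j 5) = - (gold - 1) / 2"
  "fst (ring_cell 2 j 6) = 0" "fst (ring_cell 2 j 7) = (gold - 1) / 2" "fst (ring_cell 2 j 8) = 1 / 2"
  "fst (ring_cell 2 j 9) = 1 / 2"
  unfolding fst_ring_cell fst_circ_values[of "circ' 2"] fst_circ_circ'
  using gold_sq by (simp_all add: field_simps)

lemma less_10: "n < 10 \<Longrightarrow> n = 0 \<or> n = 1 \<or> n = 2 \<or> n = 3 \<or> n = 4 \<or> n = 5 \<or> n = 6 \<or> n = 7 \<or> n = 8 \<or> n = (9 :: nat)"
  by presburger

text \<open>
  All elements of positive real part, with their real parts. In particular no element other than
  \<open>1\<close> has real part above \<open>\<phi> / 2\<close>.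
\<close>
lemma Dstar_fst_table:
  assumes "p \<in> Dstar"
  shows "p = qone \<or> fst p \<le> 0 \<or>
    fst p = gold / 2 \<and> p \<in> circ ` {1, 9} \<union> (\<lambda>(j, t). ring_cell 1 j t) ` (real ` {..<5} \<times> {0, 9}) \<or>
    fst p = 1 / 2 \<and> p \<in> (\<lambda>(j, t). ring_cell 1 j t) ` (real ` {..<5} \<times> {1, 8})
      \<union> (\<lambda>(j, t). ring_cell 2 j t) ` (real ` {..<5} \<times> {8, 9}) \<or>
    fst p = (gold - 1) / 2 \<and> p \<in> circ ` {2, 8} \<union> (\<lambda>(j, t). ring_cell 2 j t) ` (real ` {..<5} \<times> {0, 7})"
    (is "?goal p")
  using assms
proof (cases rule: Dstar_cases)
  case (spinal n)
  then show ?thesis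
    using less_10[OF spinal(1)] gold_gt
    by (elim disjE) (simp_all add: fst_spinal fst_circ_circ' circ_0)
next
  case equatorial
  from equatorial[of 0] show ?thesis by (simp add: circ_0)
next
  case (skew c j n)
  have mem: "ring_cell c (real j) t \<in> (\<lambda>(j, t). ring_cell c j t) ` (real ` {..<5} \<times> T)" if "t \<in> T" for c t T
    using that skew(2) by (intro image_eqI[of _ _ "(real j, t)"]) auto
  from skew(1) show ?thesis
  proof (elim insertE emptyE)
    assume "c = 1"
    then show ?thesis
      using less_10[OF skew(3)] gold_gt mem[of _ "{0, 9}" 1] mem[of _ "{1, 8}" 1] skew(4)
      by (elim disjE) (simp_all add: fst_inner)
  next
    assume "c = 2"
    then show ?thesis
      using less_10[OF skew(3)] gold_gt mem[of _ "{8, 9}" 2] mem[of _ "{0, 7}" 2] skew(4)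
      by (elim disjE) (simp_all add: fst_outer)
  qed
qed

lemma Dstar_fst_le:
  assumes "p \<in> Dstar" "p \<noteq> qone"
  shows "fst p \<le> gold / 2"
  using Dstar_fst_table[OF assms(1)] assms(2) gold_gt by auto

lemma card_layers:
  "finite {p \<in> Dstar. fst p = gold / 2} \<and> card {p \<in> Dstar. fst p = gold / 2} \<le> 12"
  "finite {p \<in> Dstar. fst p = 1 / 2} \<and> card {p \<in> Dstar. fst p = 1 / 2} \<le> 20"
  "finite {p \<in> Dstar. fst p = (gold - 1) / 2} \<and> card {p \<in> Dstar. fst p = (gold - 1) / 2} \<le> 12"
proof -
  have prod: "finite ((\<lambda>(j, t). ring_cell c j t) ` (real ` {..<5} \<times> {a, b})) \<and>
    card ((\<lambda>(j, t). ring_cell c j t) ` (real ` {..<5} \<times> {a, b})) \<le> 10" for a b c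
  proof -
    have "card ((\<lambda>(j, t). ring_cell c j t) ` (real ` {..<5} \<times> {a, b})) \<le> card (real ` {..<5} \<times> {a, b})"
      by (rule card_image_le) simp
    also have "\<dots> = card (real ` {..<5}) * card {a, b}" by (rule card_cartesian_product)
    also have "\<dots> \<le> 5 * 2"
    proof (rule mult_le_mono)
      show "card (real ` {..<5}) \<le> 5" using card_image_le[of "{..<5}" real] by simp
      show "card {a, b} \<le> 2" by (simp add: card_insert_if)
    qed
    finally show ?thesis by simp
  qed
  have two: "finite (circ ` {a, b}) \<and> card (circ ` {a, b}) \<le> 2" for a b
    by (simp add: card_insert_if)
  have un: "finite X \<and> card X \<le> m + n" if "X \<subseteq> A \<union> B" "finite A \<and> card A \<le> m" "finite B \<and> card B \<le> n"
    for X A B :: "quat set" and m n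
  proof -
    have "finite (A \<union> B)" using that by blast
    then have "card X \<le> card (A \<union> B)" using that(1) by (rule card_mono)
    also have "\<dots> \<le> card A + card B" by (rule card_Un_le)
    finally show ?thesis using that finite_subset[OF that(1)] by simp
  qed
  have "{p \<in> Dstar. fst p = gold / 2} \<subseteq>
      circ ` {1, 9} \<union> (\<lambda>(j, t). ring_cell 1 j t) ` (real ` {..<5} \<times> {0, 9})"
    by (rule subsetI, elim CollectE conjE, drule Dstar_fst_table, insert gold_gt, elim disjE conjE)
      simp_all
  from un[OF this two prod]
  show "finite {p \<in> Dstar. fst p = gold / 2} \<and> card {p \<in> Dstar. fst p = gold / 2} \<le> 12" by simp
  have "{p \<in> Dstar. fst p = 1 / 2} \<subseteq> (\<lambda>(j, t). ring_cell 1 j t) ` (real ` {..<5} \<times> {1, 8})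
      \<union> (\<lambda>(j, t). ring_cell 2 j t) ` (real ` {..<5} \<times> {8, 9})"
    by (rule subsetI, elim CollectE conjE, drule Dstar_fst_table, insert gold_gt, elim disjE conjE)
      simp_all
  from un[OF this prod prod]
  show "finite {p \<in> Dstar. fst p = 1 / 2} \<and> card {p \<in> Dstar. fst p = 1 / 2} \<le> 20" by simp
  have "{p \<in> Dstar. fst p = (gold - 1) / 2} \<subseteq>
      circ ` {2, 8} \<union> (\<lambda>(j, t). ring_cell 2 j t) ` (real ` {..<5} \<times> {0, 7})"
    by (rule subsetI, elim CollectE conjE, drule Dstar_fst_table, insert gold_gt, elim disjE conjE)
      simp_all
  from un[OF this two prod]
  show "finite {p \<in> Dstar. fst p = (gold - 1) / 2} \<and> card {p \<in> Dstar. fst p = (gold - 1) / 2} \<le> 12"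
    by simp
qed

section \<open>Half-spaces bounding a Voronoi cell\<close>

text \<open>
  Centres of adjacent cells are at distance \<open>\<pi> / 5\<close>, so the spherical inradius of a cell is
  \<open>\<pi> / 10\<close>.
\<close>
abbreviation "s10 \<equiv> sin (pi / 10)"
abbreviation "c10 \<equiv> cos (pi / 10)"

lemma s10_c10:
  "0 < s10" "0 < c10" "s10\<^sup>2 + c10\<^sup>2 = 1" "gold / 2 = 1 - 2 * s10\<^sup>2" "sin (pi / 5) = 2 * s10 * c10"
  "3 * s10\<^sup>2 \<le> 1" "s10 < c10" "gold / 2 < c10"
proof -
  show s: "0 < s10" by (rule sin_gt_zero) simp_all
  show c: "0 < c10" by (rule cos_gt_zero_pi) (use pi_gt_zero in linarith)+
  show one: "s10\<^sup>2 + c10\<^sup>2 = 1" by simp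
  show g: "gold / 2 = 1 - 2 * s10\<^sup>2" using cos_double_sin[of "pi / 10"] cos_pi_5 by simp
  show "sin (pi / 5) = 2 * s10 * c10" using sin_double[of "pi / 10"] by simp
  show "3 * s10\<^sup>2 \<le> 1" using g gold_gt by linarith
  have "s10\<^sup>2 < c10\<^sup>2" using g gold_gt one by linarith
  then show "s10 < c10" using c by (rule power2_less_imp_less[OF _ less_imp_le])
  have "c10 < 1"
    using one s c by (metis less_add_same_cancel2 one_power2 power2_less_imp_less zero_le_one zero_less_power)
  then have "0 < (1 - c10) * (1 + 2 * c10)" using c by simp
  also have "(1 - c10) * (1 + 2 * c10) = 1 + c10 - 2 * c10\<^sup>2"
    by (simp add: power2_eq_square algebra_simps)
  finally show "gold / 2 < c10" using g one by linarith
qed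

lemma Vor_iff:
  assumes "p \<in> Dstar"
  shows "r \<in> Vor p \<longleftrightarrow> r \<in> sphere 0 1 \<and> (\<forall>q\<in>Dstar. q \<bullet> r \<le> p \<bullet> r)"
proof -
  have "dS p r \<le> dS q r \<longleftrightarrow> q \<bullet> r \<le> p \<bullet> r" if "r \<in> sphere 0 1" "q \<in> Dstar" for q
  proof -
    have "\<bar>x \<bullet> r\<bar> \<le> 1" if "x \<in> Dstar" for x
      using Cauchy_Schwarz_ineq2[of x r] Dstar_sphere[OF that] \<open>r \<in> sphere 0 1\<close>
      by (simp add: mem_sphere_0)
    then show ?thesis unfolding dS_def using assms that by (intro arccos_le_mono) auto
  qed
  then show ?thesis unfolding Vor_def by auto
qed

lemma Dstar_separation:
  assumes "p \<in> Dstar" "q \<in> Dstar" "p \<noteq> q"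
  shows "p \<bullet> q \<le> gold / 2"
proof -
  have "qmult (qcnj p) q \<in> Dstar" by (intro Dstar_qmult Dstar_qcnj assms)
  moreover have "qmult (qcnj p) q \<noteq> qone"
  proof
    assume "qmult (qcnj p) q = qone"
    then have "qmult (qmult p (qcnj p)) q = p" by (simp add: qmult_assoc)
    then show False using assms by (simp add: qmult_cnj Dstar_sphere)
  qed
  ultimately show ?thesis using Dstar_fst_le[of "qmult (qcnj p) q"] by (simp add: fst_qmult_cnj)
qed

lemma qmult_polar_conj:
  assumes "g \<in> sphere 0 1"
  shows "qmult (qmult g (a, b *\<^sub>R v)) (qcnj g) = (a, b *\<^sub>R psi g v)"
proof -
  have 1: "fst (qmult (qmult g (a, b *\<^sub>R v)) (qcnj g)) = (g \<bullet> g) * a"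
    by (simp add: inner_quat qmult_def cross3_simps)
  have "snd (qmult (qmult g (a, b *\<^sub>R v)) (qcnj g)) = b *\<^sub>R snd (qmult (qmult g (0, v)) (qcnj g))"
    by (simp add: qmult_def cross3_simps forall_3)
  with 1 show ?thesis using assms by (simp add: prod_eq_iff qmult_psi[OF assms] sphere_quat)
qed

lemma face_Dstar:
  assumes "n \<in> face_directions"
  shows "(gold / 2, sin (pi / 5) *\<^sub>R n) \<in> Dstar"
proof -
  have conj: "(gold / 2, sin (pi / 5) *\<^sub>R psi g face_f) \<in> Dstar" if g: "g \<in> Dstar" for g
    unfolding qmult_polar_conj[OF Dstar_sphere[OF g], symmetric]
    using circ_1_Dstar by (intro Dstar_qmult Dstar_qcnj g) (simp add: circ_def cos_pi_5)
  have minus: "(gold / 2, sin (pi / 5) *\<^sub>R - v) \<in> Dstar" if "(gold / 2, sin (pi / 5) *\<^sub>R v) \<in> Dstar" for v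
    using Dstar_qcnj[OF that] by (simp add: qcnj_def)
  have f: "(gold / 2, sin (pi / 5) *\<^sub>R face_f) \<in> Dstar" using conj[OF qone_Dstar] by simp
  have nbr: "(gold / 2, sin (pi / 5) *\<^sub>R nbr k) \<in> Dstar" for k
  proof -
    define g where "g = qmult (circ (real (k + 4))) (circ' (- 1))"
    have "g \<in> Dstar" unfolding g_def by (intro Dstar_qmult circ_Dstar circ'_Dstar) simp
    moreover have "psi g face_f = nbr (1 + (k + 4))"
      unfolding g_def psi_qmult[OF circ_sphere] psi_circ'_neg_1 psi_circ_nbr ..
    moreover have "nbr (1 + (k + 4)) = nbr k"
    proof -
      have "(1 + (k + 4)) mod 5 = k mod 5" by presburger
      then show ?thesis by (metis nbr_mod)
    qed
    ultimately show ?thesis using conj by metis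
  qed
  from assms show ?thesis
    by (cases rule: face_cases) (simp_all only: f nbr minus)
qed

text \<open>
  The neighbour of \<open>p\<close> across the face with direction \<open>n\<close> is \<open>p (cos (\<pi> / 5) + n sin (\<pi> / 5))\<close>. The
  bisecting hyperplane has the unit normal \<open>p (sin (\<pi> / 10) - n cos (\<pi> / 10))\<close>, pointing towards \<open>p\<close>.
\<close>
lemma Vor_halfspace:
  assumes p: "p \<in> Dstar" and r: "r \<in> Vor p" and n: "n \<in> face_directions"
  shows "0 \<le> r \<bullet> qmult p (s10, - (c10 *\<^sub>R n))"
proof -
  define m where "m = qmult (qcnj p) r"
  have *: "qmult p x \<bullet> r = x \<bullet> m" for x by (simp add: m_def inner_qmult_cnj)
  have "qmult p (gold / 2, sin (pi / 5) *\<^sub>R n) \<in> Dstar" by (intro Dstar_qmult p face_Dstar n)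
  then have "qmult p (gold / 2, sin (pi / 5) *\<^sub>R n) \<bullet> r \<le> qmult p qone \<bullet> r"
    using r by (simp add: Vor_iff[OF p])
  then have "0 \<le> 2 * s10 * ((s10, - (c10 *\<^sub>R n)) \<bullet> m)"
    unfolding * by (simp add: inner_quat qone_def s10_c10(4,5) power2_eq_square algebra_simps)
  then have "0 \<le> (s10, - (c10 *\<^sub>R n)) \<bullet> m" using s10_c10(1) by (simp add: zero_le_mult_iff)
  then show ?thesis using *[of "(s10, - (c10 *\<^sub>R n))"] by (simp add: inner_commute)
qed

section \<open>Balls in projected cells\<close>

text \<open>
  The inverse of stereographic projection.
\<close>
definition stereo :: "real ^ 3 \<Rightarrow> quat" where
  "stereo z = ((1 - z \<bullet> z) / (1 + z \<bullet> z), (2 / (1 + z \<bullet> z)) *\<^sub>R z)"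

lemma stereo_pos: "0 < 1 + z \<bullet> (z :: real ^ 3)"
  by (simp add: add_pos_nonneg)

lemma inner_stereo: "stereo z \<bullet> N = ((1 - z \<bullet> z) * fst N + 2 * (z \<bullet> snd N)) / (1 + z \<bullet> z)"
  by (simp add: inner_quat stereo_def add_divide_distrib)

lemma stereo_sphere: "stereo z \<in> sphere 0 1"
proof -
  define t where "t = z \<bullet> z"
  have "0 < 1 + t" using stereo_pos by (simp add: t_def)
  then show ?thesis
    unfolding sphere_quat inner_stereo unfolding stereo_def t_def[symmetric]
    by (simp add: divide_simps t_def[symmetric]) (simp add: algebra_simps)
qed

lemma rho_stereo: "rho (stereo z) = z"
proof -
  have "1 + (1 - z \<bullet> z) / (1 + z \<bullet> z) = 2 / (1 + z \<bullet> z)"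
    using stereo_pos[of z] by (simp add: field_simps)
  then have "rho (stereo z) = (1 / (2 / (1 + z \<bullet> z)) * (2 / (1 + z \<bullet> z))) *\<^sub>R z"
    by (simp only: rho_def stereo_def fst_conv snd_conv scaleR_scaleR)
  moreover have "1 / x * x = 1" if "x \<noteq> 0" for x :: real using that by simp
  from this[of "2 / (1 + z \<bullet> z)"] have "1 / (2 / (1 + z \<bullet> z)) * (2 / (1 + z \<bullet> z)) = 1"
    using stereo_pos[of z] by (metis divide_eq_0_iff less_irrefl zero_neq_numeral)
  ultimately show ?thesis by (simp only: scaleR_one)
qed

lemma stereo_rho:
  assumes r: "r \<in> sphere 0 1" and ne: "r \<noteq> - qone"
  shows "stereo (rho r) = r"
proof -
  have 1: "fst r * fst r + snd r \<bullet> snd r = 1" using r by (simp add: sphere_quat inner_quat)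
  have ne1: "1 + fst r \<noteq> 0"
  proof
    assume "1 + fst r = 0"
    then have "fst r = - 1" by simp
    with 1 have "snd r = 0" by simp
    with \<open>fst r = - 1\<close> ne show False by (simp add: qone_def prod_eq_iff)
  qed
  have "snd r \<bullet> snd r = (1 - fst r) * (1 + fst r)" using 1 by (simp add: algebra_simps)
  then have z: "rho r \<bullet> rho r = (1 - fst r) / (1 + fst r)" using ne1 by (simp add: rho_def)
  then have "1 + rho r \<bullet> rho r = 2 / (1 + fst r)" "1 - rho r \<bullet> rho r = 2 * fst r / (1 + fst r)"
    using ne1 by (simp_all add: field_simps)
  then show ?thesis using ne1 by (simp add: stereo_def prod_eq_iff) (simp add: rho_def)
qed

text \<open>
  A spherical half-space \<open>r \<bullet> N \<ge> 0\<close> corresponds under stereographic projection to the condition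
  \<open>(1 - |z|\<^sup>2) Re N + 2 z \<bullet> Im N \<ge> 0\<close>. If it holds on a whole ball, the vector \<open>w\<close> encoding the ball
  satisfies \<open>w \<bullet> N \<ge> 1\<close>. The restriction to \<open>R < 1\<close> makes the ball the image of a cap smaller than a
  hemisphere and excludes the solution \<open>w \<bullet> N \<le> -1\<close> of the quadratic inequality obtained.
\<close>
lemma ball_in_halfspace:
  fixes c :: "real ^ 3" and N :: quat
  assumes R: "0 < R" "R < 1" and N: "N \<bullet> N = 1"
    and sub: "\<And>z. z \<in> cball c R \<Longrightarrow> 0 \<le> (1 - z \<bullet> z) * fst N + 2 * (z \<bullet> snd N)"
  shows "1 \<le> ((1 - c \<bullet> c + R\<^sup>2) / (2 * R), (1 / R) *\<^sub>R c) \<bullet> N"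
proof -
  define N0 Nv where "N0 = fst N" and "Nv = snd N"
  define X where "X = ((1 - c \<bullet> c + R\<^sup>2) / (2 * R), (1 / R) *\<^sub>R c) \<bullet> N"
  have X: "2 * R * X = (1 - c \<bullet> c + R\<^sup>2) * N0 + 2 * (c \<bullet> Nv)"
    using R by (simp add: X_def inner_quat N0_def Nv_def field_simps)
  define e where "e = Nv - N0 *\<^sub>R c"
  obtain u :: "real ^ 3" where u: "u \<bullet> u = 1" "u \<bullet> e = - norm e"
  proof (cases "e = 0")
    case True
    show thesis by (rule that[of "axis 1 1"]) (simp_all add: True inner_axis_axis)
  next
    case False
    show thesis
      by (rule that[of "(- (1 / norm e)) *\<^sub>R e"])
        (use False in \<open>simp_all add: dot_square_norm power2_eq_square\<close>)
  qed
  \<comment> \<open>The condition is tested at the boundary point in the worst direction \<open>u\<close>.\<close>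
  have "c + R *\<^sub>R u \<in> cball c R" using u R norm_eq_1[of u] by (simp add: dist_norm)
  from sub[OF this] have "0 \<le> 2 * R * X - 2 * R * (R * N0) + 2 * R * (u \<bullet> e)"
    unfolding X N0_def[symmetric] Nv_def[symmetric] e_def
    using u by (simp add: inner_simps inner_commute power2_eq_square algebra_simps)
  then have "0 \<le> 2 * R * (X - R * N0 - norm e)" by (simp add: u algebra_simps)
  then have le: "norm e \<le> X - R * N0" using R by (simp add: zero_le_mult_iff)
  have NN: "N0 * N0 + Nv \<bullet> Nv = 1" using N by (simp add: inner_quat N0_def Nv_def)
  have "(norm e)\<^sup>2 = Nv \<bullet> Nv + N0 * (N0 * (c \<bullet> c)) - N0 * (2 * (c \<bullet> Nv))"
    unfolding power2_norm_eq_inner e_def by (simp add: inner_simps inner_commute algebra_simps)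
  also have "2 * (c \<bullet> Nv) = 2 * R * X - (1 - c \<bullet> c + R\<^sup>2) * N0" using X by simp
  finally have "(norm e)\<^sup>2 = 1 - 2 * R * X * N0 + (R * N0)\<^sup>2"
    using NN by (simp add: power2_eq_square algebra_simps)
  moreover have "(norm e)\<^sup>2 \<le> (X - R * N0)\<^sup>2" using le by (intro power_mono) auto
  ultimately have "1 \<le> X\<^sup>2" by (simp add: power2_eq_square algebra_simps)
  then have abs: "1 \<le> \<bar>X\<bar>" using abs_le_square_iff[of 1 X] by simp
  have "\<bar>N0\<bar> \<le> 1"
  proof -
    have "N0\<^sup>2 \<le> 1" using NN inner_ge_zero[of Nv] unfolding power2_eq_square by linarith
    then show ?thesis by (simp add: abs_square_le_1)
  qed
  then have "R * \<bar>N0\<bar> \<le> R * 1" using R by (intro mult_left_mono) auto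
  moreover have "\<bar>R * N0\<bar> = R * \<bar>N0\<bar>" using R by (simp add: abs_mult)
  ultimately have "\<bar>R * N0\<bar> < 1" using R by linarith
  moreover have "R * N0 \<le> X" using le norm_ge_zero[of e] by linarith
  ultimately show ?thesis using abs unfolding X_def[symmetric] by linarith
qed

text \<open>
  The squares \<open>(n \<bullet> v)\<^sup>2\<close>, over six pairwise non-antipodal face directions \<open>n\<close>, sum to \<open>2 |v|\<^sup>2\<close>,
  so one of them is at least \<open>|v|\<^sup>2 / 3\<close>; the sign of \<open>n\<close> can then be chosen.
\<close>
lemma face_close:
  obtains n where "n \<in> face_directions" "0 \<le> n \<bullet> v" "v \<bullet> v \<le> 3 * (n \<bullet> v)\<^sup>2"
proof -
  define S :: "(real ^ 3) list" where "S = [face_f, nbr 0, nbr 1, nbr 2, nbr 3, nbr 4]"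
  have "(\<Sum>n\<leftarrow>S. (n \<bullet> v)\<^sup>2) = 2 * ((x_coord * x_coord + y_coord * y_coord) * (v \<bullet> v))"
    unfolding S_def
    by (simp add: face_f_def nbr_simps inner_vec_def sum_3 power2_eq_square algebra_simps)
  then have sum: "(\<Sum>n\<leftarrow>S. (n \<bullet> v)\<^sup>2) = 2 * (v \<bullet> v)" by (simp add: xy_unit)
  have "\<exists>n\<in>set S. v \<bullet> v \<le> 3 * (n \<bullet> v)\<^sup>2"
  proof (rule ccontr)
    assume "\<not> ?thesis"
    then have "3 * (n \<bullet> v)\<^sup>2 < v \<bullet> v" if "n \<in> set S" for n using that by auto
    from this[of face_f] this[of "nbr 0"] this[of "nbr 1"] this[of "nbr 2"] this[of "nbr 3"] this[of "nbr 4"]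
    show False using sum unfolding S_def by simp
  qed
  then obtain n where n: "n \<in> set S" "v \<bullet> v \<le> 3 * (n \<bullet> v)\<^sup>2" by blast
  have nF: "n \<in> face_directions" using n(1) by (auto simp: S_def nbr_in_faces face_f_in_faces)
  show thesis
  proof (cases "0 \<le> n \<bullet> v")
    case True
    with n nF that show ?thesis by blast
  next
    case False
    with n nF that[of "- n"] show ?thesis by (simp add: uminus_face)
  qed
qed

text \<open>
  Write \<open>w = p (a + v)\<close> with \<open>v\<close> imaginary, \<open>t = |v|\<close>, \<open>s = sin (\<pi> / 10)\<close> and \<open>C = cos (\<pi> / 10)\<close>.
  The hypotheses say \<open>a s \<ge> 1 + C n \<bullet> v\<close> for all faces \<open>n\<close>. A face at small angle to \<open>v\<close> gives
  \<open>h s \<ge> C + s t\<close>, because \<open>3 s\<^sup>2 \<le> 1\<close>, while \<open>Re w \<ge> a Re p - t\<close>; the terms in \<open>t\<close> cancel.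
\<close>
lemma curvature_bound:
  fixes w :: quat
  assumes p: "p \<in> sphere 0 1" "0 \<le> fst p" and h: "0 \<le> h" "w \<bullet> w = h\<^sup>2 + 1"
    and faces: "\<And>n. n \<in> face_directions \<Longrightarrow> 1 \<le> w \<bullet> qmult p (s10, - (c10 *\<^sub>R n))"
  shows "(c10 + fst p) / s10 \<le> h + fst w"
proof -
  define m where "m = qmult (qcnj p) w"
  define a v t where "a = fst m" and "v = snd m" and "t = norm v"
  have w: "w = qmult p m" using p by (simp add: m_def qmult_cnj flip: qmult_assoc)
  have pp: "p \<bullet> p = 1" using p by (simp add: sphere_quat)
  have face: "1 \<le> a * s10 - c10 * (n \<bullet> v)" if "n \<in> face_directions" for n
    using faces[OF that] unfolding w inner_qmult_left pp
    by (simp add: inner_quat a_def v_def inner_commute)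
  have t2: "t\<^sup>2 = v \<bullet> v" by (simp add: t_def power2_norm_eq_inner)
  have norm: "a\<^sup>2 + t\<^sup>2 = h\<^sup>2 + 1"
    using h(2) unfolding w inner_qmult_left pp by (simp add: inner_quat a_def v_def t2 power2_eq_square[of "fst m"])
  obtain n where n: "n \<in> face_directions" "0 \<le> n \<bullet> v" "v \<bullet> v \<le> 3 * (n \<bullet> v)\<^sup>2"
    by (rule face_close)
  define k where "k = n \<bullet> v"
  have k: "0 \<le> k" "t\<^sup>2 \<le> 3 * k\<^sup>2" "1 + c10 * k \<le> a * s10"
    using n face[OF n(1)] by (simp_all add: k_def t2)
  have t0: "0 \<le> t" by (simp add: t_def)
  note s = s10_c10(1) and c = s10_c10(2) and sc = s10_c10(3)
  have "(s10 * t)\<^sup>2 \<le> k\<^sup>2"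
  proof -
    have "3 * s10\<^sup>2 * t\<^sup>2 \<le> 1 * t\<^sup>2" by (rule mult_right_mono[OF s10_c10(6)]) simp
    with k(2) show ?thesis by (simp add: power_mult_distrib)
  qed
  then have stk: "s10 * t \<le> k" using k(1) by (rule power2_le_imp_le)
  have "(1 + c10 * k)\<^sup>2 \<le> (a * s10)\<^sup>2" using k c by (intro power_mono) auto
  moreover have "(h * s10)\<^sup>2 = (a * s10)\<^sup>2 + (s10 * t)\<^sup>2 - s10\<^sup>2"
  proof -
    have "(h * s10)\<^sup>2 = (a\<^sup>2 + t\<^sup>2 - 1) * s10\<^sup>2" using norm by (simp add: power_mult_distrib)
    then show ?thesis by (simp add: power_mult_distrib algebra_simps)
  qed
  moreover have "c10 * (s10 * t) \<le> c10 * k" using stk c by (intro mult_left_mono) auto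
  moreover have "0 \<le> (c10 * k)\<^sup>2" by simp
  moreover have "(1 + c10 * k)\<^sup>2 = 1 + (c10 * k)\<^sup>2 + 2 * (c10 * k)"
    "(c10 + s10 * t)\<^sup>2 = c10\<^sup>2 + (s10 * t)\<^sup>2 + 2 * (c10 * (s10 * t))"
    by (simp_all add: power2_sum)
  ultimately have "(c10 + s10 * t)\<^sup>2 \<le> (h * s10)\<^sup>2" using sc by linarith
  then have hs: "c10 + s10 * t \<le> h * s10" by (rule power2_le_imp_le) (use h s in auto)
  have "1 \<le> a * s10" using k(3) mult_nonneg_nonneg[OF less_imp_le[OF c] k(1)] by linarith
  then have "fst p * 1 \<le> fst p * (a * s10)" using p(2) by (intro mult_left_mono)
  moreover have "snd p \<bullet> v \<le> t"
  proof -
    have "snd p \<bullet> snd p \<le> 1" using pp zero_le_square[of "fst p"] unfolding inner_quat by linarith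
    then have "norm (snd p) \<le> 1" by (simp add: norm_le_square)
    then have "norm (snd p) * norm v \<le> 1 * norm v" by (intro mult_right_mono) auto
    with norm_cauchy_schwarz[of "snd p" v] show ?thesis by (simp add: t_def)
  qed
  then have "s10 * (snd p \<bullet> v) \<le> s10 * t" using s by (intro mult_left_mono) auto
  moreover have "fst w = fst p * a - snd p \<bullet> v" by (simp add: w qmult_def a_def v_def)
  then have "fst w * s10 = fst p * (a * s10) - s10 * (snd p \<bullet> v)"
    by (simp only: left_diff_distrib mult.assoc mult.commute[of s10])
  ultimately have "c10 + fst p \<le> h * s10 + fst w * s10" using hs by linarith
  then have "c10 + fst p \<le> (h + fst w) * s10" by (simp add: algebra_simps)
  then show ?thesis using s by (simp add: field_simps)
qed

lemma north_pole_notin_Vor: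
  assumes "p \<in> Dstar" "p \<noteq> - qone"
  shows "- qone \<notin> Vor p"
proof
  assume "- qone \<in> Vor p"
  moreover have "- qone \<in> Dstar" by (intro uminus_Dstar qone_Dstar)
  ultimately have "- qone \<bullet> - qone \<le> p \<bullet> - qone" using Vor_iff[OF assms(1)] by blast
  then have "1 \<le> p \<bullet> - qone" by (simp add: inner_quat qone_def)
  moreover have "p \<bullet> - qone \<le> gold / 2" by (rule Dstar_separation) (use assms \<open>- qone \<in> Dstar\<close> in auto)
  ultimately show False using gold_gt by linarith
qed

lemma stereo_Vor:
  assumes "p \<in> Dstar" "p \<noteq> - qone" "z \<in> rho ` Vor p"
  shows "stereo z \<in> Vor p"
proof -
  obtain r where r: "r \<in> Vor p" "z = rho r" using assms(3) by blast
  then have "r \<noteq> - qone" using north_pole_notin_Vor assms by blast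
  moreover have "r \<in> sphere 0 1" using r by (simp add: Vor_iff[OF assms(1)])
  ultimately show ?thesis using r by (simp add: stereo_rho)
qed

text \<open>
  Upper bound on the inradius of a projected cell. A ball that is too large is first shrunk to
  radius below \<open>1\<close>, which is possible since the bound is itself below \<open>1\<close>.
\<close>
lemma ball_in_cell_radius:
  assumes p: "p \<in> Dstar" "0 \<le> fst p" and R: "0 < R" and sub: "cball c R \<subseteq> rho ` Vor p"
  shows "R \<le> s10 / (c10 + fst p)"
proof (rule ccontr)
  define M where "M = s10 / (c10 + fst p)"
  assume "\<not> R \<le> s10 / (c10 + fst p)"
  then have "M < R" by (simp add: M_def)
  have M: "0 < M" "M < 1" using s10_c10 p(2) by (auto simp: M_def)
  define R' where "R' = min R ((M + 1) / 2)"
  have R': "0 < R'" "R' < 1" "M < R'" "R' \<le> R" using M \<open>M < R\<close> R by (auto simp: R'_def min_less_iff_disj)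
  define w :: quat where "w = ((1 - c \<bullet> c + R'\<^sup>2) / (2 * R'), (1 / R') *\<^sub>R c)"
  define h where "h = (1 + c \<bullet> c - R'\<^sup>2) / (2 * R')"
  have pole: "p \<noteq> - qone" using p by (auto simp: qone_def)
  have "R'\<^sup>2 \<le> 1" using R' by (simp add: power_le_one)
  then have "0 \<le> h" unfolding h_def
    using R' inner_ge_zero[of c] by (intro divide_nonneg_pos) linarith+
  moreover have "w \<bullet> w = h\<^sup>2 + 1"
    using R' by (simp add: w_def h_def inner_quat divide_simps) (simp add: power2_eq_square algebra_simps)
  moreover have "1 \<le> w \<bullet> qmult p (s10, - (c10 *\<^sub>R n))" if n: "n \<in> face_directions" for n
    unfolding w_def
  proof (rule ball_in_halfspace)
    show "0 < R'" "R' < 1" by (rule R')+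
    show "qmult p (s10, - (c10 *\<^sub>R n)) \<bullet> qmult p (s10, - (c10 *\<^sub>R n)) = 1"
      using Dstar_sphere[OF p(1)] s10_c10(3) face_unit[OF n] unfolding inner_qmult_left
      by (simp add: sphere_quat inner_quat power2_eq_square)
    fix z assume "z \<in> cball c R'"
    then have "z \<in> rho ` Vor p" using sub R' by auto
    from Vor_halfspace[OF p(1) stereo_Vor[OF p(1) pole this] n]
    show "0 \<le> (1 - z \<bullet> z) * fst (qmult p (s10, - (c10 *\<^sub>R n))) + 2 * (z \<bullet> snd (qmult p (s10, - (c10 *\<^sub>R n))))"
      using stereo_pos[of z] by (simp add: inner_stereo zero_le_divide_iff)
  qed
  ultimately have "(c10 + fst p) / s10 \<le> h + fst w"
    using curvature_bound[OF Dstar_sphere[OF p(1)] p(2)] by blast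
  also have "\<dots> = 1 / R'" using R' by (simp add: h_def w_def field_simps)
  finally have "R' \<le> M" using R' s10_c10 p(2) by (simp add: M_def field_simps)
  with R' show False by simp
qed

text \<open>
  With \<open>s = sin\<^sup>2 \<beta>\<close> for a \<open>\<beta>\<close> below a right angle: if the unit vectors \<open>p\<close> and \<open>q\<close> are at angle
  at least \<open>2 \<beta>\<close>, then a point \<open>r\<close> at angle at most \<open>\<beta>\<close> from \<open>p\<close> is no closer to \<open>q\<close> than to \<open>p\<close>.
\<close>
lemma cap_in_halfspace:
  fixes p q r :: "'a :: real_inner"
  assumes unit: "p \<bullet> p = 1" "q \<bullet> q = 1" "r \<bullet> r = 1"
    and pq: "p \<bullet> q \<le> 1 - 2 * s" and pr: "1 - s \<le> (p \<bullet> r)\<^sup>2" "0 \<le> p \<bullet> r" and s: "0 \<le> s"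
  shows "q \<bullet> r \<le> p \<bullet> r"
proof (rule ccontr)
  assume "\<not> q \<bullet> r \<le> p \<bullet> r"
  define \<delta> \<rho> \<epsilon> where "\<delta> = 1 - p \<bullet> q" and "\<rho> = p \<bullet> r" and "\<epsilon> = q \<bullet> r - p \<bullet> r"
  have \<epsilon>: "0 < \<epsilon>" using \<open>\<not> q \<bullet> r \<le> p \<bullet> r\<close> by (simp add: \<epsilon>_def)
  have \<delta>: "2 * s \<le> \<delta>" "0 \<le> \<rho>" using pq pr by (simp_all add: \<delta>_def \<rho>_def)
  have "((r - \<rho> *\<^sub>R p) \<bullet> ((p - q) - \<delta> *\<^sub>R p))\<^sup>2
      \<le> ((r - \<rho> *\<^sub>R p) \<bullet> (r - \<rho> *\<^sub>R p)) * (((p - q) - \<delta> *\<^sub>R p) \<bullet> ((p - q) - \<delta> *\<^sub>R p))"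
    by (rule Cauchy_Schwarz_ineq)
  also have "(r - \<rho> *\<^sub>R p) \<bullet> ((p - q) - \<delta> *\<^sub>R p) = - (\<epsilon> + \<delta> * \<rho>)"
    using unit by (simp add: \<delta>_def \<rho>_def \<epsilon>_def inner_simps inner_commute algebra_simps)
  also have "(r - \<rho> *\<^sub>R p) \<bullet> (r - \<rho> *\<^sub>R p) = 1 - \<rho>\<^sup>2"
    using unit by (simp add: \<rho>_def inner_simps inner_commute power2_eq_square algebra_simps)
  also have "((p - q) - \<delta> *\<^sub>R p) \<bullet> ((p - q) - \<delta> *\<^sub>R p) = 2 * \<delta> - \<delta>\<^sup>2"
    using unit by (simp add: \<delta>_def inner_simps inner_commute power2_eq_square algebra_simps)
  finally have 1: "(\<epsilon> + \<delta> * \<rho>)\<^sup>2 \<le> (1 - \<rho>\<^sup>2) * (2 * \<delta> - \<delta>\<^sup>2)" by (simp only: power2_minus)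
  have "0 \<le> \<delta> * (\<delta> - 2 * (1 - \<rho>\<^sup>2))" using \<delta> pr(1) s by (simp add: \<rho>_def)
  then have "(1 - \<rho>\<^sup>2) * (2 * \<delta> - \<delta>\<^sup>2) \<le> (\<delta> * \<rho>)\<^sup>2" by (simp add: power2_eq_square algebra_simps)
  with 1 have "(\<epsilon> + \<delta> * \<rho>)\<^sup>2 \<le> (\<delta> * \<rho>)\<^sup>2" by simp
  moreover have "0 \<le> \<delta> * \<rho>" using \<delta> s by simp
  ultimately have "\<epsilon> + \<delta> * \<rho> \<le> \<delta> * \<rho>" by (rule power2_le_imp_le)
  with \<epsilon> show False by simp
qed

text \<open>
  The image of the inscribed cap of angular radius \<open>\<pi> / 10\<close> about \<open>p\<close>. The inequality \<open>Re p > - C\<close>,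
  obtained from the separation of \<open>- p\<close> and \<open>1\<close>, keeps the north pole outside the cap.
\<close>
lemma ball_in_cell:
  assumes p: "p \<in> Dstar" "p \<noteq> - qone"
  shows "0 < c10 + fst p"
    and "cball ((1 / (c10 + fst p)) *\<^sub>R snd p) (s10 / (c10 + fst p)) \<subseteq> rho ` Vor p"
proof -
  have "- p \<noteq> qone" using p(2) by (metis minus_minus)
  from Dstar_fst_le[OF uminus_Dstar[OF p(1)] this] have "- fst p \<le> gold / 2" by simp
  with s10_c10(8) show K: "0 < c10 + fst p" by simp
  have pp: "fst p * fst p + snd p \<bullet> snd p = 1"
    using Dstar_sphere[OF p(1)] by (simp add: sphere_quat inner_quat)
  show "cball ((1 / (c10 + fst p)) *\<^sub>R snd p) (s10 / (c10 + fst p)) \<subseteq> rho ` Vor p"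
  proof
    define K where "K = c10 + fst p"
    have K: "0 < K" using K by (simp add: K_def)
    fix z assume "z \<in> cball ((1 / (c10 + fst p)) *\<^sub>R snd p) (s10 / (c10 + fst p))"
    then have "norm (z - (1 / K) *\<^sub>R snd p) \<le> s10 / K" by (simp add: K_def dist_norm norm_minus_commute)
    then have "K * norm (z - (1 / K) *\<^sub>R snd p) \<le> s10" using K by (simp add: field_simps)
    also have "K * norm (z - (1 / K) *\<^sub>R snd p) = norm (K *\<^sub>R (z - (1 / K) *\<^sub>R snd p))" using K by simp
    also have "K *\<^sub>R (z - (1 / K) *\<^sub>R snd p) = K *\<^sub>R z - snd p" using K by (simp add: scaleR_diff_right)
    finally have "(norm (K *\<^sub>R z - snd p))\<^sup>2 \<le> s10\<^sup>2" by (intro power_mono) auto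
    then have "K * K * (z \<bullet> z) - 2 * K * (z \<bullet> snd p) + snd p \<bullet> snd p \<le> s10\<^sup>2"
      unfolding power2_norm_eq_inner by (simp add: inner_simps inner_commute algebra_simps)
    moreover have "s10\<^sup>2 - snd p \<bullet> snd p = - (c10 - fst p) * K"
      using pp s10_c10(3) by (simp add: K_def power2_eq_square algebra_simps)
    ultimately have "0 \<le> K * (- (c10 - fst p) - K * (z \<bullet> z) + 2 * (z \<bullet> snd p))" by (simp add: algebra_simps)
    then have "0 \<le> - (c10 - fst p) - K * (z \<bullet> z) + 2 * (z \<bullet> snd p)" using K by (simp add: zero_le_mult_iff)
    then have "c10 * (1 + z \<bullet> z) \<le> (1 - z \<bullet> z) * fst p + 2 * (z \<bullet> snd p)"
      by (simp add: K_def algebra_simps)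
    then have cap: "c10 \<le> stereo z \<bullet> p" using stereo_pos[of z] by (simp add: inner_stereo pos_le_divide_eq)
    have "stereo z \<in> Vor p" unfolding Vor_iff[OF p(1)]
    proof (intro conjI ballI)
      show "stereo z \<in> sphere 0 1" by (rule stereo_sphere)
      fix q assume q: "q \<in> Dstar"
      show "q \<bullet> stereo z \<le> p \<bullet> stereo z"
      proof (cases "p = q")
        case False
        show ?thesis
        proof (rule cap_in_halfspace[where s = "s10\<^sup>2"])
          show "p \<bullet> p = 1" "q \<bullet> q = 1" "stereo z \<bullet> stereo z = 1"
            using Dstar_sphere[OF p(1)] Dstar_sphere[OF q] stereo_sphere by (simp_all add: sphere_quat)
          show "p \<bullet> q \<le> 1 - 2 * s10\<^sup>2" using Dstar_separation[OF p(1) q False] s10_c10(4) by simp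
          have "c10\<^sup>2 \<le> (p \<bullet> stereo z)\<^sup>2"
            using cap s10_c10(2) by (intro power_mono) (simp_all add: inner_commute)
          then show "1 - s10\<^sup>2 \<le> (p \<bullet> stereo z)\<^sup>2" using s10_c10(3) by linarith
          show "0 \<le> p \<bullet> stereo z" using cap s10_c10(2) by (simp add: inner_commute)
        qed simp
      qed simp
    qed
    then show "z \<in> rho ` Vor p" by (rule rev_image_eqI) (simp add: rho_stereo)
  qed
qed

lemma isometry_image_cball:
  fixes g :: "real ^ 3 \<Rightarrow> real ^ 3"
  assumes "orientation_preserving_isometry g"
  shows "g ` cball c R = cball (g c) R" "inj g" "surj g"
proof -
  obtain f b where f: "orthogonal_transformation f" and g: "g = (\<lambda>v. f v + b)"
    using assms by (auto simp: orientation_preserving_isometry_def SO3_def)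
  have "g ` cball c R = (+) b ` f ` cball c R" by (simp add: g image_image add.commute)
  also have "\<dots> = cball (b + f c) R"
    by (simp only: image_orthogonal_transformation_cball[OF f] cball_translation)
  finally show "g ` cball c R = cball (g c) R" by (simp add: g add.commute)
  show "inj g" using orthogonal_transformation_inj[OF f] by (simp add: g inj_def)
  show "surj g" unfolding surj_def
  proof
    fix v
    obtain x where "v - b = f x" using orthogonal_transformation_surj[OF f] by (rule surjE)
    then show "\<exists>x. v = g x" by (auto simp: g algebra_simps)
  qed
qed

text \<open>
  The assumption \<open>Re p \<ge> 0\<close> on one of the two cells suffices: comparing inradii with the lower bound for \<open>p'\<close>
  shows \<open>Re p \<le> Re p'\<close>, after which the exact value is available for both.
\<close>
lemma congruent_cells_same_layer:
  assumes p: "p \<in> Dstar" "0 \<le> fst p" and p': "p' \<in> Dstar" "p' \<noteq> - qone"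
    and g: "orientation_preserving_isometry g" and eq: "g ` rho ` Vor p = rho ` Vor p'"
  shows "fst p' = fst p"
proof -
  note g = isometry_image_cball[OF g]
  have pole: "p \<noteq> - qone" using p by (auto simp: qone_def)
  have le: "fst p \<le> fst p'"
  proof -
    obtain c where c: "(1 / (c10 + fst p')) *\<^sub>R snd p' = g c" using g(3) by (metis surjD)
    have "g ` cball c (s10 / (c10 + fst p')) \<subseteq> g ` rho ` Vor p"
      using ball_in_cell(2)[OF p'] by (simp add: g(1) c eq)
    then have "cball c (s10 / (c10 + fst p')) \<subseteq> rho ` Vor p" using g(2) by (simp add: inj_image_subset_iff)
    then have "s10 / (c10 + fst p') \<le> s10 / (c10 + fst p)"
      using ball_in_cell(1)[OF p'] s10_c10(1) by (intro ball_in_cell_radius[OF p]) auto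
    then show ?thesis
      using ball_in_cell(1)[OF p'] s10_c10(1,2) p(2) by (simp add: divide_le_cancel frac_le_eq field_simps)
  qed
  have "g ` cball ((1 / (c10 + fst p)) *\<^sub>R snd p) (s10 / (c10 + fst p)) \<subseteq> rho ` Vor p'"
    using ball_in_cell(2)[OF p(1) pole] unfolding eq[symmetric] by (rule image_mono)
  then have "s10 / (c10 + fst p) \<le> s10 / (c10 + fst p')"
    unfolding g(1) using le p(2) s10_c10(1,2) by (intro ball_in_cell_radius[OF p'(1)]) auto
  then have "fst p' \<le> fst p"
    using le p(2) s10_c10(1,2) by (simp add: field_simps)
  with le show ?thesis by simp
qed

lemma projected_cell_inj:
  assumes p: "p \<in> Dstar" "p \<noteq> - qone" and p': "p' \<in> Dstar" "p' \<noteq> - qone"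
    and eq: "rho ` Vor p = rho ` Vor p'"
  shows "p = p'"
proof (rule ccontr)
  assume ne: "p \<noteq> p'"
  have pp: "p \<bullet> p = 1" using Dstar_sphere[OF p(1)] by (simp add: sphere_quat)
  have "p \<in> Vor p"
    unfolding Vor_iff[OF p(1)]
  proof (intro conjI ballI)
    show "p \<in> sphere 0 1" by (rule Dstar_sphere[OF p(1)])
    fix q assume "q \<in> Dstar"
    then show "q \<bullet> p \<le> p \<bullet> p"
      using Dstar_separation[of q p] p(1) gold_gt pp by (cases "q = p") auto
  qed
  then have "stereo (rho p) \<in> Vor p'" using stereo_Vor[OF p'] eq by blast
  then have "p \<in> Vor p'" using Dstar_sphere[OF p(1)] p(2) by (simp add: stereo_rho)
  then have "1 \<le> p' \<bullet> p" using p(1) pp by (auto simp: Vor_iff[OF p'(1)])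
  with Dstar_separation[OF p(1) p'(1) ne] gold_gt show False by (simp add: inner_commute)
qed

section \<open>Rings and ribs\<close>

lemma spinal_ring_eq: "spinal_ring = range (\<lambda>n :: nat. circ (real n))"
proof
  have "x \<in> range (\<lambda>n :: nat. circ (real n))" if "x \<in> generate S3 {ring_gen}" for x
    using that
  proof (induction rule: generate.induct)
    case one
    show ?case by (rule range_eqI[of _ _ 0]) (simp add: circ_0)
  next
    case (incl h)
    then show ?case by (intro range_eqI[of _ _ 1]) (simp add: ring_gen_circ)
  next
    case (inv h)
    then show ?case using circ_period[of "- 1"]
      by (intro range_eqI[of _ _ 9]) (simp add: ring_gen_circ inv_S3 circ_sphere circ_cnj)
  next
    case (eng h1 h2)
    then show ?case by (auto simp: circ_add simp flip: of_nat_add)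
  qed
  then show "spinal_ring \<subseteq> range (\<lambda>n :: nat. circ (real n))" unfolding spinal_ring_def by blast
  have "circ (real n) \<in> generate S3 {ring_gen}" for n
  proof (induction n)
    case 0
    show ?case using generate.one[of S3 "{ring_gen}"] by (simp add: circ_0)
  next
    case (Suc n)
    have "ring_gen \<in> generate S3 {ring_gen}" by (rule generate.incl) simp
    from generate.eng[OF this Suc] show ?case by (simp add: ring_gen_circ circ_add)
  qed
  then show "range (\<lambda>n :: nat. circ (real n)) \<subseteq> spinal_ring" unfolding spinal_ring_def by blast
qed

text \<open>
  The right coset of the spinal ring containing \<open>g\<close>.
\<close>
definition ring_through :: "quat \<Rightarrow> quat set" where
  "ring_through g = range (\<lambda>n :: nat. qmult (circ (real n)) g)"

lemma r_coset_spinal_ring: "spinal_ring #>\<^bsub>S3\<^esub> g = ring_through g"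
  unfolding r_coset_def ring_through_def spinal_ring_eq by auto

lemma rings_eq: "rings = ring_through ` Dstar"
proof -
  have "spinal_ring #>\<^bsub>S3\<lparr>carrier := Dstar\<rparr>\<^esub> g = ring_through g" for g
    using r_coset_spinal_ring by (simp add: r_coset_def)
  then show ?thesis unfolding rings_def RCOSETS_def by auto
qed

lemma ring_through_circ: "ring_through (qmult (circ (real k)) g) = ring_through g"
proof
  have "qmult (circ (real n)) (qmult (circ (real k)) g) = qmult (circ (real (n + k))) g" for n
    by (simp add: circ_add flip: qmult_assoc)
  then show "ring_through (qmult (circ (real k)) g) \<subseteq> ring_through g"
    unfolding ring_through_def by blast
  \<comment> \<open>Since \<open>q\<^bsup>10\<^esup> = 1\<close>, the inverse of \<open>q\<^bsup>k\<^esup>\<close> is \<open>q\<^bsup>9k\<^esup>\<close>.\<close>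
  have "qmult (circ (real n)) g = qmult (circ (real (n + 9 * k))) (qmult (circ (real k)) g)" for n
  proof -
    have "(n + 9 * k + k) mod 10 = n mod 10" by presburger
    then have "circ (real (n + 9 * k + k)) = circ (real n)" by (metis circ_mod)
    then show ?thesis by (simp add: circ_add flip: qmult_assoc)
  qed
  then show "ring_through g \<subseteq> ring_through (qmult (circ (real k)) g)"
    unfolding ring_through_def by blast
qed

lemma inner_rings_eq:
  "inner_rings = (\<lambda>j. ring_through (qmult (circ' 1) (circ (- real j)))) ` {0..4}"
  unfolding inner_rings_def circ_pow r_coset_spinal_ring
  by (simp add: inv_S3 circ_sphere circ_cnj ring_gen_circ)

lemma outer_ring_cases:
  assumes "A \<in> outer_rings"
  obtains j where "j < 5" "A = ring_through (qmult (circ' 2) (circ (- real j)))"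
proof -
  from assms have A: "A \<in> rings" "A \<noteq> spinal_ring" "A \<notin> equatorial_rings" "A \<notin> inner_rings"
    by (simp_all add: outer_rings_def)
  then obtain g where g: "g \<in> Dstar" "A = ring_through g" unfolding rings_eq by blast
  from g(1) show thesis
  proof (cases rule: Dstar_cases)
    case (spinal n)
    then have "A = ring_through qone" using ring_through_circ[of n qone] g(2) by simp
    then show thesis using A(2) by (simp add: ring_through_def spinal_ring_eq)
  next
    case equatorial
    have "dS p qone = pi / 2" if "p \<in> A" for p
      using that equatorial by (auto simp: g(2) ring_through_def dS_def inner_quat qone_def)
    with A show thesis by (simp add: equatorial_rings_def)
  next
    case (skew c j n)
    have "A = ring_through (qmult (circ' c) (circ (- real j)))"
      using ring_through_circ[of "j + n" "qmult (circ' c) (circ (- real j))"]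
      by (simp add: g(2) skew(4) ring_cell_def)
    moreover from this have "c \<noteq> 1" using A(4) skew(2) by (auto simp: inner_rings_eq)
    ultimately show thesis using that skew(1,2) by auto
  qed
qed

lemma ring_cell_in_ring_through: "ring_cell c (real j) (real n) \<in> ring_through (qmult (circ' c) (circ (- real j)))"
  unfolding ring_cell_def ring_through_def by (rule range_eqI[of _ _ "j + n"]) simp

lemma ring_cell_eq_imp:
  assumes "ring_cell c j s = ring_cell c j t"
  shows "fst (circ (s - t)) = 1"
proof -
  have "ring_cell c j t \<in> sphere 0 1" unfolding ring_cell_def by (intro qmult_sphere circ_sphere)
  moreover have "ring_cell c j s = qmult (circ (s - t)) (ring_cell c j t)"
    by (simp add: ring_cell_def circ_add add.commute flip: qmult_assoc)
  then have "qmult (ring_cell c j t) (qcnj (ring_cell c j t)) = qmult (circ (s - t)) (qmult (ring_cell c j t) (qcnj (ring_cell c j t)))"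
    using assms by (metis qmult_assoc)
  ultimately show ?thesis by (simp add: qmult_cnj)
qed

lemma ring_through_Dstar:
  assumes "c \<in> {1, 2}"
  shows "ring_through (qmult (circ' c) (circ (- real j))) \<subseteq> Dstar"
  unfolding ring_through_def using assms by (auto intro!: Dstar_qmult circ_Dstar circ'_Dstar)

lemma strictly_southern_pos:
  assumes "p \<in> A" "p \<in> sphere 0 1" "0 < fst p"
  shows "p \<in> strictly_southern A"
proof -
  have "\<bar>fst p\<bar> \<le> 1"
    using Cauchy_Schwarz_ineq2[of p qone] assms(2) qone_sphere
    by (simp add: mem_sphere_0 inner_quat) (simp add: qone_def)
  then have "arccos (fst p) < arccos 0" using assms(3) by (subst arccos_less_mono) auto
  then show ?thesis
    using assms(1) by (simp add: strictly_southern_def southern_def dS_def inner_quat qone_def)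
qed

text \<open>
  The rib \<open>S\<close> has at least two cells in the layer of real part \<open>a\<close>.
\<close>
definition has_pair_at :: "quat set \<Rightarrow> real \<Rightarrow> bool" where
  "has_pair_at S a \<longleftrightarrow> (\<exists>x\<in>S. \<exists>y\<in>S. x \<noteq> y \<and> fst x = a \<and> fst y = a)"

lemma has_pair_at_ring_cells:
  assumes A: "A = ring_through (qmult (circ' c) (circ (- real j)))" and c: "c \<in> {1, 2}"
    and S: "strictly_southern A \<subseteq> S" and a: "0 < a"
    and m: "fst (ring_cell c (real j) (real m)) = a" and n: "fst (ring_cell c (real j) (real n)) = a"
    and ne: "fst (circ (real n - real m)) \<noteq> 1"
  shows "has_pair_at S a"
proof -
  have "ring_cell c (real j) (real k) \<in> S" if "fst (ring_cell c (real j) (real k)) = a" for k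
  proof -
    have "ring_cell c (real j) (real k) \<in> A" unfolding A by (rule ring_cell_in_ring_through)
    moreover from this have "ring_cell c (real j) (real k) \<in> sphere 0 1"
      using ring_through_Dstar[OF c] A Dstar_sphere by blast
    ultimately show ?thesis using that a S strictly_southern_pos by blast
  qed
  moreover have "ring_cell c (real j) (real m) \<noteq> ring_cell c (real j) (real n)" using ne ring_cell_eq_imp by metis
  ultimately show ?thesis using m n unfolding has_pair_at_def by blast
qed

lemma southern_subset: "strictly_southern A \<subseteq> southern A" "southern A \<subseteq> A"
  by (auto simp: southern_def strictly_southern_def)

lemma inner_rib_pairs:
  assumes "S \<in> inner_ribs"
  shows "S \<subseteq> Dstar" "has_pair_at S (gold / 2)" "has_pair_at S (1 / 2)"
proof -
  obtain A where A: "A \<in> inner_rings" and S: "S = southern A \<or> S = strictly_southern A"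
    using assms by (auto simp: inner_ribs_def)
  obtain j where A: "A = ring_through (qmult (circ' 1) (circ (- real j)))"
    using A by (auto simp: inner_rings_eq)
  show "S \<subseteq> Dstar" using S southern_subset[of A] ring_through_Dstar[of 1 j] A by auto
  have sub: "strictly_southern A \<subseteq> S" using S southern_subset by auto
  show "has_pair_at S (gold / 2)"
    by (rule has_pair_at_ring_cells[OF A _ sub, of _ 0 9]) (use gold_gt in \<open>simp_all add: fst_inner fst_spinal\<close>)
  show "has_pair_at S (1 / 2)"
    by (rule has_pair_at_ring_cells[OF A _ sub, of _ 1 8]) (use gold_gt in \<open>simp_all add: fst_inner fst_spinal\<close>)
qed

lemma outer_rib_pairs:
  assumes "S \<in> outer_ribs"
  shows "S \<subseteq> Dstar" "has_pair_at S ((gold - 1) / 2)" "has_pair_at S (1 / 2)"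
proof -
  obtain A where "A \<in> outer_rings" and S: "S = southern A \<or> S = strictly_southern A"
    using assms by (auto simp: outer_ribs_def)
  then obtain j where A: "A = ring_through (qmult (circ' 2) (circ (- real j)))"
    by (auto elim: outer_ring_cases)
  show "S \<subseteq> Dstar" using S southern_subset[of A] ring_through_Dstar[of 2 j] A by auto
  have sub: "strictly_southern A \<subseteq> S" using S southern_subset by auto
  show "has_pair_at S ((gold - 1) / 2)"
    by (rule has_pair_at_ring_cells[OF A _ sub, of _ 0 7]) (use gold_gt in \<open>simp_all add: fst_outer fst_spinal\<close>)
  show "has_pair_at S (1 / 2)"
    by (rule has_pair_at_ring_cells[OF A _ sub, of _ 8 9])
      (use gold_gt in \<open>simp_all add: fst_outer fst_circ_circ'\<close>)
qed

section \<open>Counting placed ribs\<close>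

lemma placed_cell_layer:
  assumes P: "valid_placement P" and x: "x \<in> fst P" "x \<in> Dstar" "0 \<le> fst x"
  shows "snd P ` rho ` Vor x \<in> (\<lambda>p. rho ` Vor p) ` {p \<in> Dstar. fst p = fst x}"
proof -
  have "snd P ` rho ` Vor x \<in> placed_cells P" using x(1) by (simp add: placed_cells_def)
  then obtain x' where x': "x' \<in> Dstar" "x' \<noteq> - qone" "snd P ` rho ` Vor x = rho ` Vor x'"
    using P unfolding valid_placement_def by blast
  have "fst x' = fst x"
    using P by (intro congruent_cells_same_layer[OF x(2,3) x'(1,2) _ x'(3)]) (simp add: valid_placement_def)
  with x' show ?thesis by blast
qed

lemma num_placed_le:
  assumes puzzle: "puzzle Ps" and sub: "\<And>S. S \<in> Rs \<Longrightarrow> S \<subseteq> Dstar"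
    and pairs: "\<And>S. S \<in> Rs \<Longrightarrow> has_pair_at S a" and a: "0 \<le> a"
    and layer: "finite {p \<in> Dstar. fst p = a} \<and> card {p \<in> Dstar. fst p = a} \<le> N"
  shows "2 * num_placed Rs Ps \<le> N"
proof -
  define I where "I = {k. k < length Ps \<and> fst (Ps ! k) \<in> Rs}"
  define L where "L = (\<lambda>p. rho ` Vor p) ` {p \<in> Dstar. fst p = a}"
  define T where "T k = placed_cells (Ps ! k) \<inter> L" for k
  have L: "finite L" "card L \<le> N"
    unfolding L_def using layer card_image_le le_trans by blast+
  have two: "2 \<le> card (T k)" if "k \<in> I" for k
  proof -
    define P where "P = Ps ! k"
    have k: "k < length Ps" "fst P \<in> Rs" using that by (simp_all add: I_def P_def)
    have P: "valid_placement P" using puzzle k(1) unfolding puzzle_def P_def by auto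
    obtain x y where xy: "x \<in> fst P" "y \<in> fst P" "x \<noteq> y" "fst x = a" "fst y = a"
      using pairs[OF k(2)] unfolding has_pair_at_def by blast
    have D: "x \<in> Dstar" "y \<in> Dstar" using xy sub[OF k(2)] by blast+
    have pole: "x \<noteq> - qone" "y \<noteq> - qone" using xy a by (auto simp: qone_def)
    have mem: "snd P ` rho ` Vor x \<in> T k" "snd P ` rho ` Vor y \<in> T k"
      using placed_cell_layer[OF P xy(1) D(1)] placed_cell_layer[OF P xy(2) D(2)] xy a
      by (auto simp: T_def L_def P_def[symmetric] placed_cells_def)
    have "inj (snd P)" using P isometry_image_cball(2) by (auto simp: valid_placement_def)
    then have "snd P ` rho ` Vor x \<noteq> snd P ` rho ` Vor y"
      using projected_cell_inj[OF D(1) pole(1) D(2) pole(2)] xy(3) by (auto simp: inj_image_eq_iff)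
    then have "2 = card {snd P ` rho ` Vor x, snd P ` rho ` Vor y}" by simp
    also have "\<dots> \<le> card (T k)" using mem L(1) by (intro card_mono) (auto simp: T_def)
    finally show ?thesis .
  qed
  have fin: "finite I" by (simp add: I_def)
  have "2 * card I = (\<Sum>k\<in>I. 2)" by simp
  also have "\<dots> \<le> (\<Sum>k\<in>I. card (T k))" by (rule sum_mono) (rule two)
  also have "\<dots> = card (\<Union>k\<in>I. T k)"
  proof (rule card_UN_disjoint[symmetric])
    show "finite I" by (rule fin)
    show "\<forall>k\<in>I. finite (T k)" using L(1) by (simp add: T_def)
    show "\<forall>k\<in>I. \<forall>l\<in>I. k \<noteq> l \<longrightarrow> T k \<inter> T l = {}"
      using puzzle unfolding puzzle_def I_def T_def by blast
  qed
  also have "\<dots> \<le> card L" using L(1) by (intro card_mono) (auto simp: T_def)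
  also have "\<dots> \<le> N" by (rule L(2))
  finally show ?thesis by (simp add: num_placed_def length_filter_conv_card I_def)
qed

theorem theorem7p3:
  fixes Ps :: "placed_rib list"
  assumes "puzzle Ps"
  shows "num_placed inner_ribs Ps \<le> 6 \<and>
         num_placed outer_ribs Ps \<le> 6 \<and>
         num_placed (inner_ribs \<union> outer_ribs) Ps \<le> 10"
proof -
  have "2 * num_placed inner_ribs Ps \<le> 12"
    by (rule num_placed_le[OF assms, of _ "gold / 2"])
      (use inner_rib_pairs card_layers gold_gt in auto)
  moreover have "2 * num_placed outer_ribs Ps \<le> 12"
    by (rule num_placed_le[OF assms, of _ "(gold - 1) / 2"])
      (use outer_rib_pairs card_layers gold_gt in auto)
  moreover have "2 * num_placed (inner_ribs \<union> outer_ribs) Ps \<le> 20"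
  proof (rule num_placed_le[OF assms, of _ "1 / 2"])
    fix S assume "S \<in> inner_ribs \<union> outer_ribs"
    then show "S \<subseteq> Dstar" "has_pair_at S (1 / 2)"
      using inner_rib_pairs outer_rib_pairs by blast+
  qed (use card_layers in auto)
  ultimately show ?thesis by simp
qed

end
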